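(* Let $f\in\mathcal{A}$. Then $f$ has no wandering intervals.
   Context: Let $M=[0,1]$. The class $\mathcal{A}$ consists of maps $f:M\to M$ with the following properties. (1) Piecewise structure. There is a finite set $C\subset M$ such that $f$ restricted to each connected component of $M\setminus C$ is a $C^1$ diffeomorphism onto its image, and the one-sided limits $f(c\pm)=\lim_{x\to c\pm}f(x)$ exist for every $c\in C$. Each $c\in C$ is regarded as two points $c+$ and $c-$, according to the one-sided neighbourhood being considered. For a point of $C$ we write $f(c)$ for $f(c\pm)$ on the relevant side, and $f^n(c)=f^{n-1}(f(c\pm))$ for $n\ge1$. (2) Orders. For each $c\in C$ and each side there is a number $l(c\pm)\in[1,\infty)$ such that, for $x$ in the corresponding one-sided neighbourhood of $c$, $$|Df(x)|\approx|x-c|^{l(c\pm)-1},\qquad |f(x)-f(c\pm)|\approx|x-c|^{l(c\pm)}.$$ Here $g\approx h$ means that $g/h$ is bounded above and below by positive constants. Points of $C$ are called critical points, whether $l(c\pm)>1$ or $l(c\pm)=1$. (3) Negative Schwarzian derivative. The function $|f'|^{-1/2}$ is convex on each component of $M\setminus C$. (4) First summability condition. For every $c\in C$ (each side), $$\sum_{n=1}^{\infty}\Big(\frac{|f^n(c)-\tilde c|^{l(\tilde c)}}{|f^n(c)-\tilde c|^{l(c)}\,|Df^n(f(c))|}\Big)^{1/l(c)}<\infty.$$ Here $\tilde c$ is the point of $C$ closest to $f^n(c)$, $l(\tilde c)$ is the order of $\tilde c$ on the side where $f^n(c)$ lies, and $l(c)$ is the order on the side of $c$ under consideration. In particular, all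 terms are defined and finite, so critical orbits never hit $C$. (5) Second summability condition. For every $c\in C$ (each side), $$\sum_{n=1}^{\infty}|Df^n(f(c))|^{-1/l(c)}<\infty.$$ An interval $J\subset M$ is a wandering interval for $f$ if it satisfies all of the following: - the sets $J,f(J),f^2(J),\dots$ are pairwise disjoint; - $J$ is not contained in the basin of attraction of an attracting periodic orbit; - $f^n|_J$ is a homeomorphism onto its image for every $n>0$. *)

theory Defs
  imports "HOL-Analysis.Analysis"
begin

text \<open>The phase space is M = [0,1] (written {0..1} throughout).
  A side of a point c is encoded by a boolean: True = the right side (c+),
  False = the left side (c-).  A side is meaningful only if it lies in M.\<close>

definition valid_side :: "real \<Rightarrow> bool \<Rightarrow> bool" where
  "valid_side c s \<longleftrightarrow> (if s then c < 1 else 0 < c)"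

definition side_filter :: "real \<Rightarrow> bool \<Rightarrow> real filter" where
  "side_filter c s = (if s then at_right c else at_left c)"

definition side_nbhd :: "real \<Rightarrow> bool \<Rightarrow> real \<Rightarrow> real set" where
  "side_nbhd c s \<delta> = (if s then {c<..<c+\<delta>} else {c-\<delta><..<c})"

definition onesided_val :: "(real \<Rightarrow> real) \<Rightarrow> real \<Rightarrow> bool \<Rightarrow> real" where
  "onesided_val f c s = Lim (side_filter c s) f"

definition closest_crit :: "real set \<Rightarrow> real \<Rightarrow> real" where
  "closest_crit C x = (ARG_MIN (\<lambda>c. \<bar>x - c\<bar>) c. c \<in> C)"

text \<open>Derivative of the n-th iterate at y, by the chain rule: Df^n(y).\<close>
definition iter_deriv :: "(real \<Rightarrow> real) \<Rightarrow> (real \<Rightarrow> real) \<Rightarrow> nat \<Rightarrow> real \<Rightarrow> real" where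
  "iter_deriv f Df n y = (\<Prod>k<n. Df ((f ^^ k) y))"

text \<open>The n-th term (n \<ge> 1) of the first summability series for the critical point c,
  side s: here y = f(c s), so f^n(c) = f^(n-1)(y).\<close>
definition summ1_term :: "(real \<Rightarrow> real) \<Rightarrow> (real \<Rightarrow> real) \<Rightarrow> real set
    \<Rightarrow> (real \<Rightarrow> bool \<Rightarrow> real) \<Rightarrow> real \<Rightarrow> bool \<Rightarrow> nat \<Rightarrow> real" where
  "summ1_term f Df C l c s n =
     (let y = onesided_val f c s;
          z = (f ^^ (n - 1)) y;
          ct = closest_crit C z;
          s' = (ct < z)
      in (\<bar>z - ct\<bar> powr l ct s' / (\<bar>z - ct\<bar> powr l c s * \<bar>iter_deriv f Df n y\<bar>))
           powr (1 / l c s))"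

definition class_A :: "(real \<Rightarrow> real) \<Rightarrow> bool" where
  "class_A f \<longleftrightarrow>
    (\<forall>x\<in>{0..1}. f x \<in> {0..1}) \<and>
    (\<exists>(C::real set) (Df::real \<Rightarrow> real) (l::real \<Rightarrow> bool \<Rightarrow> real).
       finite C \<and> C \<subseteq> {0..1} \<and>
       \<comment> \<open>(1) piecewise C^1 diffeomorphism, one-sided limits at C\<close>
       (\<forall>x\<in>{0..1} - C. (f has_real_derivative Df x) (at x within {0..1}) \<and> Df x \<noteq> 0) \<and>
       continuous_on ({0..1} - C) Df \<and>
       (\<forall>c\<in>C. \<forall>s. valid_side c s \<longrightarrow> (\<exists>L. (f \<longlongrightarrow> L) (side_filter c s))) \<and>
       \<comment> \<open>(2) orders\<close>
       (\<forall>c\<in>C. \<forall>s. valid_side c s \<longrightarrow> 1 \<le> l c s \<and>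
          (\<exists>\<delta>>0. \<exists>A>0. \<exists>B>0. \<forall>x \<in> side_nbhd c s \<delta> \<inter> ({0..1} - C).
             A * \<bar>x - c\<bar> powr (l c s - 1) \<le> \<bar>Df x\<bar> \<and>
             \<bar>Df x\<bar> \<le> B * \<bar>x - c\<bar> powr (l c s - 1) \<and>
             A * \<bar>x - c\<bar> powr (l c s) \<le> \<bar>f x - onesided_val f c s\<bar> \<and>
             \<bar>f x - onesided_val f c s\<bar> \<le> B * \<bar>x - c\<bar> powr (l c s))) \<and>
       \<comment> \<open>(3) negative Schwarzian: |f'|^(-1/2) convex on each component of M - C\<close>
       (\<forall>x\<in>{0..1} - C. convex_on (connected_component_set ({0..1} - C) x)
                                   (\<lambda>y. 1 / sqrt \<bar>Df y\<bar>)) \<and>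
       \<comment> \<open>(4) first summability condition (critical orbits never hit C)\<close>
       (\<forall>c\<in>C. \<forall>s. valid_side c s \<longrightarrow>
          (\<forall>k. (f ^^ k) (onesided_val f c s) \<notin> C) \<and>
          summable (\<lambda>n. summ1_term f Df C l c s (Suc n))) \<and>
       \<comment> \<open>(5) second summability condition\<close>
       (\<forall>c\<in>C. \<forall>s. valid_side c s \<longrightarrow>
          summable (\<lambda>n. \<bar>iter_deriv f Df (Suc n) (onesided_val f c s)\<bar> powr (- 1 / l c s))))"

text \<open>Periodic orbits, basins, attracting periodic orbits (basin has non-empty interior,
  as in de Melo--van Strien).\<close>
definition periodic_orbit :: "(real \<Rightarrow> real) \<Rightarrow> real set \<Rightarrow> bool" where
  "periodic_orbit f Orb \<longleftrightarrow>
     (\<exists>p k. p \<in> {0..1} \<and> 0 < k \<and> (f ^^ k) p = p \<and> Orb = {(f ^^ i) p | i. i < k})"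

definition basin :: "(real \<Rightarrow> real) \<Rightarrow> real set \<Rightarrow> real set" where
  "basin f Orb = {x \<in> {0..1}. (\<lambda>n. infdist ((f ^^ n) x) Orb) \<longlonglongrightarrow> 0}"

definition attracting_periodic_orbit :: "(real \<Rightarrow> real) \<Rightarrow> real set \<Rightarrow> bool" where
  "attracting_periodic_orbit f Orb \<longleftrightarrow> periodic_orbit f Orb \<and> interior (basin f Orb) \<noteq> {}"

definition wandering_interval :: "(real \<Rightarrow> real) \<Rightarrow> real set \<Rightarrow> bool" where
  "wandering_interval f J \<longleftrightarrow>
     is_interval J \<and> J \<subseteq> {0..1} \<and> (\<exists>a\<in>J. \<exists>b\<in>J. a < b) \<and>
     (\<forall>m n. m \<noteq> n \<longrightarrow> (f ^^ m) ` J \<inter> (f ^^ n) ` J = {}) \<and>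
     \<not> (\<exists>Orb. attracting_periodic_orbit f Orb \<and> J \<subseteq> basin f Orb) \<and>
     (\<forall>n>0. \<exists>g. homeomorphism J ((f ^^ n) ` J) (f ^^ n) g)"

end

theory Submission
  imports Defs
begin

text \<open>Call an interval a homterval if none of its iterates meets C. A homterval containing two points
  of one orbit is absorbed by a periodic orbit (a one-sided limit cycle through C is excluded because
  critical orbits avoid C), so homtervals around a wandering interval J have disjoint iterates,
  hence lengths tending to 0.

  Let K be such a homterval, containing a point of J, and pull back collars of width \<open>2\<delta>\<close> on both
  sides of the tiny interval \<open>f\<^sup>N(K)\<close> along the orbit of K. If a collar runs into a critical point c at
  time m, then f(c) lies in the collar pulled back to time m+1; with the negative Schwarzian derivative
  and the other collar as space, the hull of \<open>{c} \<union> f\<^sup>m(K)\<close> has length \<open>\<theta>\<close> with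
  \<open>\<theta>\<^bsup>l(c)\<^esup> |Df\<^bsup>N-m-1\<^esup>(f(c))| \<lesssim> \<delta>\<close>. If \<open>f\<^sup>N(K)\<close> is \<open>\<delta>/2\<close>-close to C, then so is, up to a factor,
  \<open>f\<^bsup>N-m\<^esup>(c)\<close>, and the summability condition makes the derivative so large that \<open>\<theta> \<le> \<delta>/2\<close>:
  the same situation at the earlier time m, with the same \<open>\<delta>\<close>. Descending in time, one reaches
  arbitrarily large N for which both collars pull back to time 0 without meeting C. They then have
  length at least |K|/3, so K can be thickened by the factor 5/3 and stays a homterval. Iterating
  this contradicts \<open>|K| \<le> 1\<close>.\<close>

section \<open>Monotone functions and disjoint segments\<close>

text \<open>The obstacle is to close the descent at one fixed scale \<open>\<delta>\<close>. A first
  pull-back at a smaller scale \<open>\<delta>0\<close> can rely only on a uniform positive lower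
  bound for the derivatives along critical orbits; unless it succeeds at once, it brings an iterate
  of K within \<open>\<delta>/2\<close> of C. From then on every critical point that is hit has a
  forward image within \<open>3 * \<delta>\<close> of C. Critical orbits avoid C, so for small
  \<open>\<delta>\<close> this image is a late one, and there the derivative times
  \<open>\<delta>\<close> to the power \<open>l(c) - 1\<close> exceeds any constant fixed
  beforehand: exactly what recovers \<open>\<delta>/2\<close> from the bound on
  \<open>\<theta>\<close>. The descent cannot go below a prescribed time \<open>N0\<close>, because
  before \<open>N0\<close> the end \<open>a\<close> of K keeps a distance greater than
  \<open>\<delta>\<close> from C. A collar can also be cut off at 0 or 1 and then gives no space.
  This is excluded by separate arguments, \<open>boundary_separation\<close> during the pull-back
  and \<open>boundary_not_reached\<close> at time 0. The factor 3 is the bound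
  \<open>6 * \<delta>\<close> of the distortion estimate divided by the collar width
  \<open>2 * \<delta>\<close>.\<close>

definition strictly_monotone_on :: "real set \<Rightarrow> (real \<Rightarrow> real) \<Rightarrow> bool" where
  "strictly_monotone_on U g \<longleftrightarrow>
     (\<forall>x\<in>U. \<forall>y\<in>U. x < y \<longrightarrow> g x < g y) \<or> (\<forall>x\<in>U. \<forall>y\<in>U. x < y \<longrightarrow> g y < g x)"

lemma strictly_monotone_on_subset:
  "strictly_monotone_on U g \<Longrightarrow> V \<subseteq> U \<Longrightarrow> strictly_monotone_on V g"
  unfolding strictly_monotone_on_def by blast

lemma strictly_monotone_on_compose:
  assumes "strictly_monotone_on U g" "strictly_monotone_on (g ` U) k"
  shows "strictly_monotone_on U (\<lambda>x. k (g x))"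
  using assms unfolding strictly_monotone_on_def by (elim disjE) auto

lemma strictly_monotone_on_inj: "strictly_monotone_on U g \<Longrightarrow> inj_on g U"
  unfolding strictly_monotone_on_def inj_on_def by (metis less_irrefl linorder_less_linear)

lemma closed_segment_real_mem:
  "(x::real) \<in> closed_segment u v \<longleftrightarrow> (u \<le> x \<and> x \<le> v) \<or> (v \<le> x \<and> x \<le> u)"
  by (auto simp: closed_segment_eq_real_ivl)

lemma strictly_monotone_on_segment:
  assumes "strictly_monotone_on U g" "u \<in> U" "v \<in> U" "x \<in> U" "x \<in> closed_segment u v"
  shows "g x \<in> closed_segment (g u) (g v)"
  using assms unfolding strictly_monotone_on_def closed_segment_real_mem
  by (metis linorder_le_less_linear order.order_iff_strict)

lemma is_interval_closed_segment_real: "is_interval (closed_segment (u::real) v)"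
  by (simp add: closed_segment_eq_real_ivl is_interval_cc)

lemma strictly_monotone_image_segment:
  assumes "strictly_monotone_on (closed_segment u v) g" "continuous_on (closed_segment u v) g"
  shows "g ` closed_segment u v = closed_segment (g u) (g v)"
proof
  show "g ` closed_segment u v \<subseteq> closed_segment (g u) (g v)"
    using strictly_monotone_on_segment[OF assms(1)] by auto
  have "connected (g ` closed_segment u v)"
    using assms(2) connected_continuous_image connected_segment(1) by blast
  then have "convex (g ` closed_segment u v)" 
    by (metis is_interval_connected_1 is_interval_convex_1)
  then show "closed_segment (g u) (g v) \<subseteq> g ` closed_segment u v"
    by (intro closed_segment_subset) auto
qed

text \<open>The hypothesis \<open>le\<close> says that \<open>D / G t - 1 / t\<close> has
  nonnegative derivative. In the application \<open>t\<close> is the distance from a base point,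
  \<open>G t\<close> the distance of the images and \<open>D\<close> the derivative at the base
  point.\<close>

lemma reciprocal_gap_le:
  fixes G G' :: "real \<Rightarrow> real"
  assumes "0 < s1" "s1 \<le> s2"
    and der: "\<And>t. t \<in> {s1..s2} \<Longrightarrow> (G has_real_derivative G' t) (at t within {s1..s2})"
    and pos: "\<And>t. t \<in> {s1..s2} \<Longrightarrow> 0 < G t"
    and le: "\<And>t. t \<in> {s1..s2} \<Longrightarrow> D * G' t * t\<^sup>2 \<le> (G t)\<^sup>2"
  shows "D * (1 / G s1 - 1 / G s2) \<le> 1 / s1 - 1 / s2"
proof -
  define \<phi> where "\<phi> t = D / G t - 1 / t" for t
  have d: "(\<phi> has_real_derivative (1 / t\<^sup>2 - D * G' t / (G t)\<^sup>2)) (at t within {s1..s2})"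
    if "t \<in> {s1..s2}" for t
    unfolding \<phi>_def using der[OF that] pos[OF that] that assms(1)
    by (auto intro!: derivative_eq_intros simp: power2_eq_square)
  have nn: "0 \<le> 1 / t\<^sup>2 - D * G' t / (G t)\<^sup>2" if "t \<in> {s1..s2}" for t
    using le[OF that] pos[OF that] that assms(1) by (simp add: field_simps)
  have "\<phi> s1 \<le> \<phi> s2"
  proof (rule DERIV_nonneg_imp_increasing_open[OF assms(2)])
    fix x assume x: "s1 < x" "x < s2"
    then have "at x within {s1..s2} = at x" by (intro at_within_interior) auto
    then show "\<exists>y. (\<phi> has_real_derivative y) (at x) \<and> 0 \<le> y"
      using d[of x] nn[of x] x by (intro exI[of _ "1 / x\<^sup>2 - D * G' x / (G x)\<^sup>2"]) auto
  next
    show "continuous_on {s1..s2} \<phi>"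
      by (rule DERIV_continuous_on) (rule d)
  qed
  then show ?thesis unfolding \<phi>_def by (simp add: algebra_simps)
qed

text \<open>The total Lebesgue measure is at most 1, so the lengths are summable. Segments are used
  because the order of the end points changes from one iterate to the next.\<close>

lemma disjoint_segments_shrink:
  fixes u w :: "nat \<Rightarrow> real"
  assumes in01: "\<And>n. u n \<in> {0..1}" "\<And>n. w n \<in> {0..1}"
    and disj: "\<And>m n. m \<noteq> n \<Longrightarrow> closed_segment (u m) (w m) \<inter> closed_segment (u n) (w n) = {}"
  shows "(\<lambda>n. \<bar>u n - w n\<bar>) \<longlonglongrightarrow> 0"
proof -
  have seg: "closed_segment (u n) (w n) = {min (u n) (w n)..max (u n) (w n)}" for n
    by (auto simp: closed_segment_eq_real_ivl)
  have len: "measure lborel (closed_segment (u n) (w n)) = \<bar>u n - w n\<bar>" for n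
    unfolding seg by (auto simp: min_def max_def)
  have "(\<Sum>n<N. \<bar>u n - w n\<bar>) \<le> 1" for N
  proof -
    have "(\<Sum>n<N. \<bar>u n - w n\<bar>) = (\<Sum>n<N. measure lborel (closed_segment (u n) (w n)))"
      by (simp add: len)
    also have "\<dots> = measure lborel (\<Union>n\<in>{..<N}. closed_segment (u n) (w n))"
    proof (rule measure_finite_Union[symmetric])
      show "disjoint_family_on (\<lambda>n. closed_segment (u n) (w n)) {..<N}"
        using disj by (auto simp: disjoint_family_on_def)
      show "emeasure lborel (closed_segment (u n) (w n)) \<noteq> \<infinity>" for n
        unfolding seg by simp
      show "(\<lambda>n. closed_segment (u n) (w n)) ` {..<N} \<subseteq> sets lborel"
        unfolding seg by auto
    qed simp
    also have "\<dots> \<le> measure lborel {0..1::real}"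
    proof (rule measure_mono_fmeasurable)
      show "(\<Union>n\<in>{..<N}. closed_segment (u n) (w n)) \<subseteq> {0..1}"
        using in01 by (intro UN_least closed_segment_subset) auto
      show "(\<Union>n\<in>{..<N}. closed_segment (u n) (w n)) \<in> sets lborel"
        unfolding seg by auto
      show "{0..1::real} \<in> fmeasurable lborel" by (simp add: fmeasurable_def)
    qed
    finally show ?thesis by simp
  qed
  then have "summable (\<lambda>n. \<bar>u n - w n\<bar>)"
    by (intro bounded_imp_summable[where B = 1]) (simp_all only: lessThan_Suc_atMost[symmetric] abs_ge_zero)
  then show ?thesis by (rule summable_LIMSEQ_zero)
qed

section \<open>Iterates and the negative Schwarzian derivative\<close>

locale interval_map =
  fixes f Df :: "real \<Rightarrow> real" and C :: "real set" and l :: "real \<Rightarrow> bool \<Rightarrow> real"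
  assumes maps: "x \<in> {0..1} \<Longrightarrow> f x \<in> {0..1}"
    and finite_C: "finite C" and C_subset: "C \<subseteq> {0..1}"
    and deriv: "x \<in> {0..1} - C \<Longrightarrow> (f has_real_derivative Df x) (at x within {0..1})"
    and Df_nonzero: "x \<in> {0..1} - C \<Longrightarrow> Df x \<noteq> 0"
    and Df_continuous: "continuous_on ({0..1} - C) Df"
    and side_limit: "c \<in> C \<Longrightarrow> valid_side c s \<Longrightarrow> \<exists>L. (f \<longlongrightarrow> L) (side_filter c s)"
    and order_ge_1: "c \<in> C \<Longrightarrow> valid_side c s \<Longrightarrow> 1 \<le> l c s"
    and orders: "c \<in> C \<Longrightarrow> valid_side c s \<Longrightarrow>
          \<exists>\<delta>>0. \<exists>A>0. \<exists>B>0. \<forall>x \<in> side_nbhd c s \<delta> \<inter> ({0..1} - C).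
             A * \<bar>x - c\<bar> powr (l c s - 1) \<le> \<bar>Df x\<bar> \<and>
             \<bar>Df x\<bar> \<le> B * \<bar>x - c\<bar> powr (l c s - 1) \<and>
             A * \<bar>x - c\<bar> powr (l c s) \<le> \<bar>f x - onesided_val f c s\<bar> \<and>
             \<bar>f x - onesided_val f c s\<bar> \<le> B * \<bar>x - c\<bar> powr (l c s)"
    and schwarzian: "x \<in> {0..1} - C \<Longrightarrow>
          convex_on (connected_component_set ({0..1} - C) x) (\<lambda>y. 1 / sqrt \<bar>Df y\<bar>)"
    and crit_orbit: "c \<in> C \<Longrightarrow> valid_side c s \<Longrightarrow> (f ^^ k) (onesided_val f c s) \<notin> C"
    and summability: "c \<in> C \<Longrightarrow> valid_side c s \<Longrightarrow> summable (\<lambda>n. summ1_term f Df C l c s (Suc n))"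
begin

abbreviation v :: "real \<Rightarrow> bool \<Rightarrow> real" where "v c s \<equiv> onesided_val f c s"

definition avoids :: "nat \<Rightarrow> real set \<Rightarrow> bool" where
  "avoids n I \<longleftrightarrow> I \<subseteq> {0..1} \<and> (\<forall>j<n. (f ^^ j) ` I \<inter> C = {})"

text \<open>Being an interval is kept as a separate hypothesis, so that unions and images of
  homtervals are again homtervals and only connectedness remains to be checked.\<close>

definition homterval :: "real set \<Rightarrow> bool" where
  "homterval I \<longleftrightarrow> (\<forall>n. avoids n I)"

lemma avoids_0 [simp]: "avoids 0 I \<longleftrightarrow> I \<subseteq> {0..1}"
  by (simp add: avoids_def)

lemma avoids_subset: "avoids n I \<Longrightarrow> K \<subseteq> I \<Longrightarrow> avoids n K"
  unfolding avoids_def by blast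

lemma avoids_mono: "avoids n I \<Longrightarrow> m \<le> n \<Longrightarrow> avoids m I"
  unfolding avoids_def by auto

lemma avoids_Un: "avoids n I \<Longrightarrow> avoids n K \<Longrightarrow> avoids n (I \<union> K)"
  unfolding avoids_def by blast

lemma avoids_Suc: "avoids (Suc n) I \<longleftrightarrow> I \<subseteq> {0..1} - C \<and> avoids n (f ` I)"
proof
  assume a: "avoids (Suc n) I"
  have "(f ^^ j) ` f ` I \<inter> C = {}" if "j < n" for j
  proof -
    have "(f ^^ Suc j) ` I \<inter> C = {}" using a that unfolding avoids_def by blast
    then show ?thesis by (simp only: funpow_Suc_right image_comp)
  qed
  moreover have "(f ^^ 0) ` I \<inter> C = {}" using a unfolding avoids_def by blast
  ultimately show "I \<subseteq> {0..1} - C \<and> avoids n (f ` I)"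
    using a maps unfolding avoids_def by auto
next
  assume a: "I \<subseteq> {0..1} - C \<and> avoids n (f ` I)"
  have "(f ^^ j) ` I \<inter> C = {}" if "j < Suc n" for j
  proof (cases j)
    case 0 then show ?thesis using a by auto
  next
    case (Suc i)
    then have "(f ^^ i) ` f ` I \<inter> C = {}" using a that unfolding avoids_def by auto
    then show ?thesis unfolding Suc by (simp only: funpow_Suc_right image_comp)
  qed
  then show "avoids (Suc n) I" using a unfolding avoids_def by blast
qed

lemma funpow_maps: "x \<in> {0..1} \<Longrightarrow> (f ^^ n) x \<in> {0..1}"
  by (induction n) (use maps in auto)

lemma continuous_off_C: "x \<in> {0..1} - C \<Longrightarrow> continuous (at x within {0..1}) f"
  using deriv DERIV_continuous by blast

lemma continuous_on_off_C: "U \<subseteq> {0..1} - C \<Longrightarrow> continuous_on U f"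
  unfolding continuous_on_eq_continuous_within
  using continuous_off_C continuous_within_subset by (metis Diff_subset order.trans subset_iff)

lemma Df_sign:
  assumes "is_interval U" "U \<subseteq> {0..1} - C"
  shows "(\<forall>x\<in>U. 0 < Df x) \<or> (\<forall>x\<in>U. Df x < 0)"
proof -
  have "connected (Df ` U)"
    using assms Df_continuous continuous_on_subset connected_continuous_image is_interval_connected by metis
  then have "is_interval (Df ` U)" by (simp add: is_interval_connected_1)
  moreover have "0 \<notin> Df ` U" using Df_nonzero assms(2) by force
  ultimately have "\<not> (Df x \<le> 0 \<and> 0 \<le> Df y)" if "x \<in> U" "y \<in> U" for x y
    using that unfolding is_interval_1 by blast
  then show ?thesis by (meson linorder_not_le order_less_imp_le)
qed

lemma deriv_at_interior:
  assumes "{u..w} \<subseteq> {0..1} - C" "u < x" "x < w"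
  shows "(f has_real_derivative Df x) (at x)"
proof -
  have "u \<in> {0..1}" "w \<in> {0..1}" using assms by (auto simp: subset_iff)
  then have "at x within {0..1} = at x" using assms by (intro at_within_interior) auto
  then show ?thesis using deriv[of x] assms by (metis atLeastAtMost_iff less_imp_le subset_iff)
qed

lemma strictly_monotone_f:
  assumes "is_interval U" "U \<subseteq> {0..1} - C"
  shows "strictly_monotone_on U f"
proof -
  have sub: "{u..w} \<subseteq> U" if "u \<in> U" "w \<in> U" for u w
    using assms(1) that unfolding is_interval_1 by (meson atLeastAtMost_iff subsetI)
  from Df_sign[OF assms] show ?thesis
  proof
    assume pos: "\<forall>x\<in>U. 0 < Df x"
    have "f x < f y" if "x \<in> U" "y \<in> U" "x < y" for x y
    proof (rule DERIV_pos_imp_increasing_open[OF \<open>x < y\<close>])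
      fix t assume "x < t" "t < y"
      then show "\<exists>d. DERIV f t :> d \<and> d > 0"
        using deriv_at_interior[of x y t] sub[OF that(1,2)] assms(2) pos
        by (metis atLeastAtMost_iff less_imp_le order.trans subset_iff)
    qed (use continuous_on_off_C sub[OF that(1,2)] assms(2) in \<open>blast intro: order.trans\<close>)
    then show ?thesis unfolding strictly_monotone_on_def by blast
  next
    assume neg: "\<forall>x\<in>U. Df x < 0"
    have "f y < f x" if "x \<in> U" "y \<in> U" "x < y" for x y
    proof (rule DERIV_neg_imp_decreasing_open[OF \<open>x < y\<close>])
      fix t assume "x < t" "t < y"
      then show "\<exists>d. DERIV f t :> d \<and> d < 0"
        using deriv_at_interior[of x y t] sub[OF that(1,2)] assms(2) neg
        by (metis atLeastAtMost_iff less_imp_le order.trans subset_iff)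
    qed (use continuous_on_off_C sub[OF that(1,2)] assms(2) in \<open>blast intro: order.trans\<close>)
    then show ?thesis unfolding strictly_monotone_on_def by blast
  qed
qed

lemma is_interval_image_f:
  assumes "is_interval U" "U \<subseteq> {0..1} - C"
  shows "is_interval (f ` U)"
  using assms continuous_on_off_C connected_continuous_image is_interval_connected_1 by metis

lemma iterate_regular:
  assumes "is_interval U" "avoids n U"
  shows "continuous_on U (f ^^ n) \<and> strictly_monotone_on U (f ^^ n)"
  using assms
proof (induction n arbitrary: U)
  case 0
  then show ?case by (auto simp: strictly_monotone_on_def)
next
  case (Suc n)
  then have U: "U \<subseteq> {0..1} - C" "avoids n (f ` U)" by (auto simp: avoids_Suc)
  have ih: "continuous_on (f ` U) (f ^^ n)" "strictly_monotone_on (f ` U) (f ^^ n)"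
    using Suc.IH[OF is_interval_image_f[OF Suc.prems(1) U(1)] U(2)] by auto
  have eq: "f ^^ Suc n = (\<lambda>x. (f ^^ n) (f x))" by (auto simp: funpow_Suc_right simp del: funpow.simps)
  show ?case unfolding eq
    using continuous_on_compose2[OF ih(1) continuous_on_off_C[OF U(1)]]
      strictly_monotone_on_compose[OF strictly_monotone_f[OF Suc.prems(1) U(1)] ih(2)] by auto
qed

lemma iterate_image_segment:
  assumes "avoids n (closed_segment u w)"
  shows "(f ^^ n) ` closed_segment u w = closed_segment ((f ^^ n) u) ((f ^^ n) w)"
  using iterate_regular[OF is_interval_closed_segment_real assms] strictly_monotone_image_segment by blast

lemma iterate_inj:
  assumes "avoids n I" "is_interval I"
  shows "inj_on (f ^^ n) I"
  using iterate_regular assms strictly_monotone_on_inj by blast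

lemma iterate_between:
  assumes "avoids n (closed_segment u w)" "x \<in> closed_segment u w"
  shows "(f ^^ n) x \<in> closed_segment ((f ^^ n) u) ((f ^^ n) w)"
  using iterate_image_segment[OF assms(1)] assms(2) by blast

lemma iter_deriv_Suc: "iter_deriv f Df (Suc n) x = Df x * iter_deriv f Df n (f x)"
  unfolding iter_deriv_def
  by (subst prod.lessThan_Suc_shift) (simp add: funpow_Suc_right del: funpow.simps)

lemma iter_deriv_Suc_last: "iter_deriv f Df (Suc n) x = iter_deriv f Df n x * Df ((f ^^ n) x)"
  unfolding iter_deriv_def by simp

lemma iterate_has_deriv:
  assumes "avoids n I" "x \<in> I"
  shows "((f ^^ n) has_real_derivative iter_deriv f Df n x) (at x within I)"
  using assms
proof (induction n arbitrary: I x)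
  case 0
  then show ?case by (simp add: iter_deriv_def)
next
  case (Suc n)
  then have U: "I \<subseteq> {0..1} - C" "avoids n (f ` I)" by (auto simp: avoids_Suc)
  have "((f ^^ n) has_real_derivative iter_deriv f Df n (f x)) (at (f x) within f ` I)"
    using Suc.IH[OF U(2)] Suc.prems by auto
  moreover have "(f has_real_derivative Df x) (at x within I)"
    using deriv U(1) Suc.prems(2) has_field_derivative_subset by (metis Diff_subset order.trans subset_iff)
  ultimately have "((f ^^ n) \<circ> f has_real_derivative iter_deriv f Df n (f x) * Df x) (at x within I)"
    by (rule DERIV_image_chain)
  then show ?case by (simp add: iter_deriv_Suc funpow_Suc_right mult.commute del: funpow.simps o_apply)
qed

text \<open>By convexity \<open>h = |Df|^(-1/2)\<close> lies below its chord \<open>L\<close>, so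
  \<open>|Df| \<ge> 1 / L^2\<close>, and the integral of \<open>1 / L^2\<close> from
  \<open>x\<close> to \<open>y\<close> is exactly \<open>(y - x) / (h x * h y)\<close>. Equality
  holds for Moebius maps.\<close>

lemma f_pair_inequality:
  assumes "closed_segment x y \<subseteq> {0..1} - C"
  shows "(x - y)\<^sup>2 * (\<bar>Df x\<bar> * \<bar>Df y\<bar>) \<le> (f x - f y)\<^sup>2"
proof -
  have main: "(x - y)\<^sup>2 * (\<bar>Df x\<bar> * \<bar>Df y\<bar>) \<le> (f x - f y)\<^sup>2"
    if xy: "x < y" and sub: "{x..y} \<subseteq> {0..1} - C" for x y
  proof -
    define h where "h t = 1 / sqrt \<bar>Df t\<bar>" for t
    have hpos: "0 < h t" if "t \<in> {x..y}" for t
      using Df_nonzero that sub unfolding h_def by (auto simp: subset_iff)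
    have Dfh: "\<bar>Df t\<bar> = 1 / (h t)\<^sup>2" for t
      unfolding h_def by (simp add: power_divide)
    have "{x..y} \<subseteq> connected_component_set ({0..1} - C) x"
      by (rule connected_component_maximal) (use xy sub in auto)
    then have cvx: "convex_on {x..y} h"
      using schwarzian[of x] xy sub unfolding h_def[abs_def]
      by (meson atLeastAtMost_iff convex_on_subset convex_real_interval(5) less_imp_le order_refl subset_iff)
    define L where "L t = (h y - h x) / (y - x) * (t - x) + h x" for t
    have hL: "h t \<le> L t" if "t \<in> {x..y}" for t
      using convex_onD_Icc'[OF cvx that] unfolding L_def by simp
    have Lpos: "0 < L t" if "t \<in> {x..y}" for t
      using hL[OF that] hpos[OF that] by linarith
    have Lx: "L x = h x" and Ly: "L y = h y" unfolding L_def using xy by auto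
    obtain e :: real where e: "e = 1 \<or> e = -1" "\<And>t. t \<in> {x..y} \<Longrightarrow> e * Df t = \<bar>Df t\<bar>"
    proof -
      from Df_sign[OF is_interval_cc sub] show ?thesis
      proof
        assume "\<forall>t\<in>{x..y}. 0 < Df t"
        then have "1 * Df t = \<bar>Df t\<bar>" if "t \<in> {x..y}" for t
          using that by fastforce
        then show ?thesis by (intro that[of 1]) auto
      next
        assume "\<forall>t\<in>{x..y}. Df t < 0"
        then have "- 1 * Df t = \<bar>Df t\<bar>" if "t \<in> {x..y}" for t
          using that by fastforce
        then show ?thesis by (intro that[of "-1"]) auto
      qed
    qed
    \<comment> \<open>The sign \<open>e\<close> makes \<open>e * f\<close> increasing. The
      subtracted term is the antiderivative of \<open>1 / L^2\<close> that vanishes at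
      \<open>x\<close>, because \<open>L t\<close> minus slope times \<open>t - x\<close> is
      \<open>h x\<close>.\<close>
    define \<phi> where "\<phi> t = e * (f t - f x) - (t - x) / (h x * L t)" for t
    have d: "(\<phi> has_real_derivative (\<bar>Df t\<bar> - 1 / (L t)\<^sup>2)) (at t within {x..y})"
      if t: "t \<in> {x..y}" for t
    proof -
      have fd: "(f has_real_derivative Df t) (at t within {x..y})"
        using deriv[of t] sub t has_field_derivative_subset by (metis Diff_subset order.trans subset_iff)
      have Ld: "(L has_real_derivative (h y - h x) / (y - x)) (at t within {x..y})"
        unfolding L_def using xy by (auto intro!: derivative_eq_intros)
      have hx: "h x \<noteq> 0" "L t \<noteq> 0" using hpos[of x] Lpos[OF t] xy by auto
      have "(\<phi> has_real_derivative (e * Df t - (1 * (h x * L t) - (t - x) * (h x * ((h y - h x) / (y - x)))) / (h x * L t)\<^sup>2)) (at t within {x..y})"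
        unfolding \<phi>_def using fd Ld hx
        by (auto intro!: derivative_eq_intros simp: power2_eq_square)
      moreover have "1 * (h x * L t) - (t - x) * (h x * ((h y - h x) / (y - x))) = h x * h x"
        unfolding L_def by (simp add: algebra_simps)
      ultimately show ?thesis using e(2)[OF t] hx by (simp add: power2_eq_square)
    qed
    have nn: "0 \<le> \<bar>Df t\<bar> - 1 / (L t)\<^sup>2" if t: "t \<in> {x..y}" for t
    proof -
      have "(h t)\<^sup>2 \<le> (L t)\<^sup>2" using hL[OF t] hpos[OF t] by (intro power_mono) auto
      then show ?thesis unfolding Dfh using hpos[OF t] by (simp add: frac_le)
    qed
    have "\<phi> x \<le> \<phi> y"
    proof (rule DERIV_nonneg_imp_increasing_open[of x y \<phi>])
      show "x \<le> y" using xy by simp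
      fix t assume t: "x < t" "t < y"
      then have "at t within {x..y} = at t" by (intro at_within_interior) auto
      then show "\<exists>d. (\<phi> has_real_derivative d) (at t) \<and> 0 \<le> d"
        using d[of t] nn[of t] t by (intro exI[of _ "\<bar>Df t\<bar> - 1 / (L t)\<^sup>2"]) auto
    next
      show "continuous_on {x..y} \<phi>"
        by (rule DERIV_continuous_on) (rule d)
    qed
    then have "(y - x) / (h x * h y) \<le> e * (f y - f x)"
      unfolding \<phi>_def using Ly by simp
    moreover have "0 \<le> (y - x) / (h x * h y)" using hpos[of x] hpos[of y] xy by simp
    ultimately have "((y - x) / (h x * h y))\<^sup>2 \<le> (e * (f y - f x))\<^sup>2" by (intro power_mono)
    then show ?thesis unfolding Dfh using e(1)
      by (auto simp: power_divide power_mult_distrib power2_commute)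
  qed
  consider "x < y" | "x = y" | "y < x" by linarith
  then show ?thesis
  proof cases
    case 1 then show ?thesis using main[of x y] assms by (auto simp: closed_segment_eq_real_ivl)
  next
    case 2 then show ?thesis by simp
  next
    case 3 then show ?thesis using main[of y x] assms
      by (auto simp: closed_segment_eq_real_ivl power2_commute mult.commute)
  qed
qed

text \<open>Unlike the convexity of \<open>|Df|\<^bsup>-1/2\<^esup>\<close>, this form of the negative Schwarzian condition is
  multiplicative, hence inherited by iterates.\<close>

lemma iterate_pair_inequality:
  assumes "avoids n (closed_segment x y)"
  shows "(x - y)\<^sup>2 * (\<bar>iter_deriv f Df n x\<bar> * \<bar>iter_deriv f Df n y\<bar>) \<le> ((f ^^ n) x - (f ^^ n) y)\<^sup>2"
  using assms
proof (induction n arbitrary: x y)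
  case 0
  then show ?case by (simp add: iter_deriv_def)
next
  case (Suc n)
  then have U: "closed_segment x y \<subseteq> {0..1} - C" "avoids n (f ` closed_segment x y)"
    by (auto simp: avoids_Suc)
  have "avoids 1 (closed_segment x y)" using Suc.prems avoids_mono by (metis One_nat_def Suc_le_mono zero_le)
  then have im: "f ` closed_segment x y = closed_segment (f x) (f y)"
    using iterate_image_segment[of 1] by simp
  have "(x - y)\<^sup>2 * (\<bar>iter_deriv f Df (Suc n) x\<bar> * \<bar>iter_deriv f Df (Suc n) y\<bar>)
     = (x - y)\<^sup>2 * (\<bar>Df x\<bar> * \<bar>Df y\<bar>) * (\<bar>iter_deriv f Df n (f x)\<bar> * \<bar>iter_deriv f Df n (f y)\<bar>)"
    by (simp add: iter_deriv_Suc abs_mult)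
  also have "\<dots> \<le> (f x - f y)\<^sup>2 * (\<bar>iter_deriv f Df n (f x)\<bar> * \<bar>iter_deriv f Df n (f y)\<bar>)"
    using f_pair_inequality[OF U(1)] by (intro mult_right_mono) auto
  also have "\<dots> \<le> ((f ^^ n) (f x) - (f ^^ n) (f y))\<^sup>2"
    using Suc.IH[of "f x" "f y"] U(2) im by simp
  finally show ?case by (simp add: funpow_Suc_right del: funpow.simps)
qed

lemma iter_deriv_nonzero:
  assumes "avoids n I" "x \<in> I"
  shows "iter_deriv f Df n x \<noteq> 0"
proof -
  have "Df ((f ^^ k) x) \<noteq> 0" if "k < n" for k
  proof (rule Df_nonzero)
    show "(f ^^ k) x \<in> {0..1} - C"
      using assms that funpow_maps[of x k] unfolding avoids_def by blast
  qed
  then show ?thesis unfolding iter_deriv_def by simp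
qed

text \<open>A one-sided Koebe principle: with \<open>y\<close> fixed, the pair inequality becomes a
  differential inequality for the distance to the image of \<open>y\<close>, which
  \<open>reciprocal_gap_le\<close> integrates from \<open>e\<close> to \<open>q\<close>. If
  \<open>S\<close> and \<open>R\<close> are the image lengths of the segments \<open>y e\<close> and
  \<open>e q\<close>, the result for \<open>R > 0\<close> is
  \<open>D * |e - y| \<le> S * (1 + S / R)\<close>: space beyond \<open>e\<close> controls the
  derivative at the opposite end \<open>y\<close>.\<close>

lemma distortion:
  assumes av: "avoids n (closed_segment y q)" and e: "e \<in> closed_segment y q"
  shows "\<bar>iter_deriv f Df n y\<bar> * \<bar>e - y\<bar> * \<bar>(f ^^ n) q - (f ^^ n) e\<bar>
     \<le> \<bar>(f ^^ n) e - (f ^^ n) y\<bar> * (\<bar>(f ^^ n) e - (f ^^ n) y\<bar> + \<bar>(f ^^ n) q - (f ^^ n) e\<bar>)"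
proof (cases "e = y")
  case True then show ?thesis by simp
next
  case False
  define g where "g = f ^^ n"
  define D where "D = \<bar>iter_deriv f Df n y\<bar>"
  \<comment> \<open>\<open>\<sigma>\<close> orients the segment from \<open>y\<close> to
    \<open>q\<close> and \<open>\<epsilon>\<close> below orients its image, so that \<open>t\<close>
    and \<open>G t\<close> are distances from \<open>y\<close> and from \<open>g y\<close> in all
    four cases.\<close>
  define \<sigma> :: real where "\<sigma> = (if y < q then 1 else -1)"
  have sg: "\<sigma> = 1 \<or> \<sigma> = -1" "\<sigma> * \<sigma> = 1" unfolding \<sigma>_def by auto
  define s1 s2 where "s1 = \<bar>e - y\<bar>" and "s2 = \<bar>q - y\<bar>"
  have s: "0 < s1" "s1 \<le> s2" using False e unfolding s1_def s2_def closed_segment_real_mem by auto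
  have pe: "y + \<sigma> * s1 = e" and pq: "y + \<sigma> * s2 = q"
    using e unfolding \<sigma>_def s1_def s2_def closed_segment_real_mem by auto
  have inI: "y + \<sigma> * t \<in> closed_segment y q" if "t \<in> {0..s2}" for t
    using that unfolding \<sigma>_def s2_def closed_segment_real_mem by (auto split: if_splits)
  have reg: "strictly_monotone_on (closed_segment y q) g"
    using iterate_regular[OF is_interval_closed_segment_real av] unfolding g_def by simp
  obtain \<epsilon> :: real where eps: "\<epsilon> = 1 \<or> \<epsilon> = -1"
    "\<And>t. 0 < t \<Longrightarrow> t \<le> s2 \<Longrightarrow> 0 < \<epsilon> * (g (y + \<sigma> * t) - g y)"
  proof -
    have y0: "y \<in> closed_segment y q" by simp
    from reg consider (inc) "\<forall>x\<in>closed_segment y q. \<forall>z\<in>closed_segment y q. x < z \<longrightarrow> g x < g z"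
      | (dec) "\<forall>x\<in>closed_segment y q. \<forall>z\<in>closed_segment y q. x < z \<longrightarrow> g z < g x"
      unfolding strictly_monotone_on_def by blast
    then show ?thesis
    proof cases
      case inc
      have "0 < \<sigma> * (g (y + \<sigma> * t) - g y)" if "0 < t" "t \<le> s2" for t
        using inc y0 inI[of t] that sg(1) by auto
      then show ?thesis using that[of \<sigma>] sg(1) by blast
    next
      case dec
      have "0 < (- \<sigma>) * (g (y + \<sigma> * t) - g y)" if "0 < t" "t \<le> s2" for t
        using dec y0 inI[of t] that sg(1) by auto
      then show ?thesis using that[of "- \<sigma>"] sg(1) by force
    qed
  qed
  define G where "G t = \<epsilon> * (g (y + \<sigma> * t) - g y)" for t
  define G' where "G' t = \<epsilon> * (iter_deriv f Df n (y + \<sigma> * t) * \<sigma>)" for t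
  have Gabs: "G t = \<bar>g (y + \<sigma> * t) - g y\<bar>" if "0 < t" "t \<le> s2" for t
    using eps(1) eps(2)[OF that] unfolding G_def by auto
  have "D * (1 / G s1 - 1 / G s2) \<le> 1 / s1 - 1 / s2"
  proof (rule reciprocal_gap_le[OF s])
    fix t assume t: "t \<in> {s1..s2}"
    then have t0: "0 < t" "t \<le> s2" using s by auto
    show "0 < G t" using eps(2)[OF t0] unfolding G_def .
    have "(g has_real_derivative iter_deriv f Df n (y + \<sigma> * t)) (at (y + \<sigma> * t) within closed_segment y q)"
      unfolding g_def using iterate_has_deriv[OF av] inI[of t] t0 by auto
    moreover have "(\<lambda>t. y + \<sigma> * t) ` {s1..s2} \<subseteq> closed_segment y q"
      using inI s by force
    ultimately have gd: "(g has_real_derivative iter_deriv f Df n (y + \<sigma> * t))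
        (at (y + \<sigma> * t) within (\<lambda>t. y + \<sigma> * t) ` {s1..s2})"
      by (rule has_field_derivative_subset)
    have ld: "((\<lambda>t. y + \<sigma> * t) has_real_derivative \<sigma>) (at t within {s1..s2})"
      by (auto intro!: derivative_eq_intros)
    have "((\<lambda>t. g (y + \<sigma> * t)) has_real_derivative iter_deriv f Df n (y + \<sigma> * t) * \<sigma>) (at t within {s1..s2})"
      using DERIV_image_chain[OF gd ld] by (simp add: o_def)
    then show "(G has_real_derivative G' t) (at t within {s1..s2})"
      unfolding G_def G'_def by (auto intro!: derivative_eq_intros)
    \<comment> \<open>The pair inequality for \<open>y\<close> and the moving point is precisely the
      hypothesis of \<open>reciprocal_gap_le\<close>.\<close>
    have sub: "closed_segment y (y + \<sigma> * t) \<subseteq> closed_segment y q"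
      using inI[of t] t0 by (intro closed_segment_subset) auto
    have "(y - (y + \<sigma> * t))\<^sup>2 * (D * \<bar>iter_deriv f Df n (y + \<sigma> * t)\<bar>) \<le> (g y - g (y + \<sigma> * t))\<^sup>2"
      unfolding D_def g_def by (rule iterate_pair_inequality[OF avoids_subset[OF av sub]])
    moreover have "(g y - g (y + \<sigma> * t))\<^sup>2 = (G t)\<^sup>2"
      unfolding Gabs[OF t0] by (simp add: power2_commute)
    moreover have "(y - (y + \<sigma> * t))\<^sup>2 = t\<^sup>2" using sg(1) by auto
    moreover have "G' t \<le> \<bar>iter_deriv f Df n (y + \<sigma> * t)\<bar>"
      unfolding G'_def using eps(1) sg(1) by auto
    then have "D * G' t * t\<^sup>2 \<le> D * \<bar>iter_deriv f Df n (y + \<sigma> * t)\<bar> * t\<^sup>2"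
      unfolding D_def by (intro mult_right_mono mult_left_mono) auto
    ultimately show "D * G' t * t\<^sup>2 \<le> (G t)\<^sup>2" by (simp add: mult.commute mult.left_commute)
  qed
  moreover have "1 / s1 - 1 / s2 \<le> 1 / s1" using s by simp
  ultimately have main: "D * (1 / G s1 - 1 / G s2) \<le> 1 / s1" by linarith
  define S R where "S = \<bar>g e - g y\<bar>" and "R = \<bar>g q - g e\<bar>"
  have G1: "G s1 = S" using Gabs[of s1] s pe unfolding S_def by simp
  have "g e \<in> closed_segment (g y) (g q)"
    unfolding g_def by (rule iterate_between[OF av e])
  then have G2: "G s2 = S + R" using Gabs[of s2] s pq unfolding S_def R_def closed_segment_real_mem by auto
  have Spos: "0 < S" using eps(2)[of s1] s G1 unfolding G_def by auto
  have R0: "0 \<le> R" unfolding R_def by simp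
  have "1 / S - 1 / (S + R) = R / (S * (S + R))" using Spos R0 by (simp add: field_simps)
  then have "D * (R / (S * (S + R))) \<le> 1 / s1" using main unfolding G1 G2 by simp
  moreover have "0 < S * (S + R)" using Spos R0 by simp
  ultimately have "D * s1 * R \<le> S * (S + R)" using s(1) by (simp add: field_simps)
  then show ?thesis unfolding D_def s1_def S_def R_def g_def by simp
qed

end

section \<open>Critical points\<close>

text \<open>The property is demanded for all smaller positive values too, so the minimum of the
  finitely many thresholds works although \<open>P\<close> need not be monotone.\<close>

lemma finite_uniform_bound:
  assumes "finite S"
    and "\<And>x. x \<in> S \<Longrightarrow> \<exists>e>0. \<forall>e'::real. 0 < e' \<and> e' \<le> e \<longrightarrow> P x e'"
  shows "\<exists>e>0. \<forall>e'. 0 < e' \<and> e' \<le> e \<longrightarrow> (\<forall>x\<in>S. P x e')"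
  using assms
proof (induction S rule: finite_induct)
  case empty
  show ?case by (rule exI[of _ 1]) auto
next
  case (insert a S)
  obtain e1 where e1: "e1 > 0" "\<forall>e'. 0 < e' \<and> e' \<le> e1 \<longrightarrow> (\<forall>x\<in>S. P x e')"
    using insert by blast
  obtain e2 where e2: "e2 > 0" "\<forall>e'. 0 < e' \<and> e' \<le> e2 \<longrightarrow> P a e'"
    using insert.prems[of a] by blast
  show ?case using e1 e2 by (intro exI[of _ "min e1 e2"]) auto
qed

lemma closest_crit:
  assumes "finite C" "C \<noteq> {}"
  shows "closest_crit C z \<in> C" "c \<in> C \<Longrightarrow> \<bar>z - closest_crit C z\<bar> \<le> \<bar>z - c\<bar>"
proof -
  have eq: "closest_crit C z = arg_min_on (\<lambda>c. \<bar>z - c\<bar>) C"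
    unfolding closest_crit_def arg_min_on_def by simp
  show "closest_crit C z \<in> C" unfolding eq using arg_min_if_finite(1)[OF assms] .
  show "c \<in> C \<Longrightarrow> \<bar>z - closest_crit C z\<bar> \<le> \<bar>z - c\<bar>"
    unfolding eq using arg_min_if_finite(2)[OF assms, of "\<lambda>c. \<bar>z - c\<bar>"] by (meson linorder_le_less_linear)
qed

lemma side_filter_nontrivial: "side_filter c s \<noteq> bot"
  unfolding side_filter_def by simp

lemma eventually_side_filter:
  assumes "x \<noteq> c" "s = (c < x)"
  shows "eventually (\<lambda>t. t \<in> closed_segment c x - {c}) (side_filter c s)"
proof (cases s)
  case True
  then have "eventually (\<lambda>t. t \<in> closed_segment c x - {c}) (at_right c)"
    using assms by (intro eventually_at_rightI[of c x]) (auto simp: closed_segment_real_mem)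
  then show ?thesis using True by (simp add: side_filter_def)
next
  case False
  then have "eventually (\<lambda>t. t \<in> closed_segment c x - {c}) (at_left c)"
    using assms by (intro eventually_at_leftI[of x c]) (auto simp: closed_segment_real_mem)
  then show ?thesis using False by (simp add: side_filter_def)
qed

context interval_map
begin

lemma finite_sides: "finite {(c, s). c \<in> C \<and> valid_side c s}"
  by (rule finite_subset[of _ "C \<times> UNIV"]) (use finite_C in auto)

lemma tendsto_v:
  assumes "c \<in> C" "valid_side c s"
  shows "(f \<longlongrightarrow> v c s) (side_filter c s)"
  using side_limit[OF assms] tendsto_Lim[OF side_filter_nontrivial] unfolding onesided_val_def by metis

lemma valid_sideI:
  assumes "x \<in> {0..1}" "c \<in> {0..1}" "x \<noteq> c" "s = (c < x)"
  shows "valid_side c s"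
  using assms unfolding valid_side_def by auto

text \<open>This carries bounds on a branch over to the critical value: the side filter eventually
  enters the segment towards \<open>x\<close>, and closed sets contain their limits. The side is
  given by a witness \<open>x\<close>, as \<open>c < x\<close>, the form in which sides arise
  later.\<close>

lemma v_limit_closed:
  assumes "c \<in> C" "x \<in> {0..1}" "x \<noteq> c" "closed S"
    and "\<And>t. t \<in> closed_segment c x - {c} \<Longrightarrow> f t \<in> S"
  shows "v c (c < x) \<in> S"
proof (rule Lim_in_closed_set[OF \<open>closed S\<close> _ side_filter_nontrivial])
  show "(f \<longlongrightarrow> v c (c < x)) (side_filter c (c < x))"
    using assms C_subset by (intro tendsto_v valid_sideI) auto
  show "\<forall>\<^sub>F t in side_filter c (c < x). f t \<in> S"
    using eventually_side_filter[OF assms(3) refl] by (rule eventually_mono) (rule assms(5))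
qed

lemma v_unit:
  assumes "c \<in> C" "valid_side c s"
  shows "v c s \<in> {0..1}"
proof -
  define x :: real where "x = (if s then 1 else 0)"
  have x: "x \<in> {0..1}" "x \<noteq> c" "s = (c < x)"
    using assms C_subset unfolding x_def valid_side_def by (auto split: if_splits)
  have "closed_segment c x \<subseteq> {0..1}"
    using assms(1) C_subset x(1) by (intro closed_segment_subset) auto
  then have "f t \<in> {0..1}" if "t \<in> closed_segment c x - {c}" for t
    using that by (intro maps) auto
  then show ?thesis
    using v_limit_closed[OF assms(1) x(1,2), of "{0..1}"] x(3) by blast
qed

lemma v_avoids:
  assumes "c \<in> C" "valid_side c s"
  shows "avoids n {v c s}"
  using v_unit[OF assms] crit_orbit[OF assms] unfolding avoids_def by auto

text \<open>A value 0 or 1 would be a local extremum at an interior point, where the derivative is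
  nonzero. It guarantees that a truncated collar, pulled back exactly, again ends at the boundary of
  M.\<close>

lemma interior_value:
  assumes "x \<in> {0<..<1} - C"
  shows "f x \<in> {0<..<1}"
proof -
  have d: "DERIV f x :> Df x"
    using deriv[of x] assms at_within_interior[of x "{0..1}"] by auto
  define r where "r = min x (1 - x)"
  have r: "0 < r" using assms unfolding r_def by auto
  have un: "f y \<in> {0..1}" if "\<bar>x - y\<bar> < r" for y
    using that by (intro maps) (auto simp: r_def min_def split: if_splits)
  have "f x \<noteq> 0"
  proof
    assume "f x = 0"
    then have "Df x = 0" using DERIV_local_min[OF d r] un by auto
    then show False using Df_nonzero assms by auto
  qed
  moreover have "f x \<noteq> 1"
  proof
    assume "f x = 1"
    then have "Df x = 0" using DERIV_local_max[OF d r] un by auto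
    then show False using Df_nonzero assms by auto
  qed
  ultimately show ?thesis using maps[of x] assms by auto
qed

text \<open>Strict monotonicity is available only away from \<open>c\<close>; the critical value
  enters by letting \<open>t\<close> tend to \<open>c\<close> in \<open>btw\<close>.\<close>

lemma side_monotone:
  assumes "c \<in> C" "x \<in> {0..1}" "x \<noteq> c" "closed_segment c x \<inter> C = {c}"
    and x1: "x1 \<in> closed_segment c x" "x1 \<noteq> c"
  shows "f x1 \<in> closed_segment (v c (c < x)) (f x)"
proof (cases "x1 = x")
  case False
  define U where "U = closed_segment c x - {c}"
  have U01: "closed_segment c x \<subseteq> {0..1}"
    using assms C_subset by (intro closed_segment_subset) auto
  have "is_interval U"
    using assms(3) unfolding U_def is_interval_1 by (auto simp: closed_segment_real_mem)
  moreover have "U \<subseteq> {0..1} - C" using U01 assms(4) unfolding U_def by blast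
  ultimately have mono: "strictly_monotone_on U f" by (rule strictly_monotone_f)
  have inU: "x1 \<in> U" "x \<in> U" using x1 assms(3) unfolding U_def by auto
  have ne: "f x1 \<noteq> f x" using strictly_monotone_on_inj[OF mono] inU False by (auto simp: inj_on_def)
  have sub: "closed_segment c x1 - {c} \<subseteq> U"
    using x1 unfolding U_def by (auto simp: closed_segment_real_mem)
  have btw: "f x1 \<in> closed_segment (f t) (f x)" if "t \<in> closed_segment c x1 - {c}" for t
  proof (rule strictly_monotone_on_segment[OF mono _ inU(2,1)])
    show "t \<in> U" using sub that by blast
    show "x1 \<in> closed_segment t x" using that x1 by (auto simp: closed_segment_real_mem)
  qed
  have x101: "x1 \<in> {0..1}" using U01 x1 by blast
  have side: "(c < x1) = (c < x)" using x1 by (auto simp: closed_segment_real_mem)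
  show ?thesis
  proof (cases "f x1 < f x")
    case True
    then have "f t \<in> {..f x1}" if "t \<in> closed_segment c x1 - {c}" for t
      using btw[OF that] by (auto simp: closed_segment_real_mem)
    then have "v c (c < x1) \<in> {..f x1}" by (intro v_limit_closed[OF assms(1) x101 x1(2)]) auto
    then show ?thesis using True side by (auto simp: closed_segment_real_mem)
  next
    case False
    then have "f t \<in> {f x1..}" if "t \<in> closed_segment c x1 - {c}" for t
      using btw[OF that] ne by (auto simp: closed_segment_real_mem)
    then have "v c (c < x1) \<in> {f x1..}" by (intro v_limit_closed[OF assms(1) x101 x1(2)]) auto
    then show ?thesis using False side by (auto simp: closed_segment_real_mem)
  qed
qed simp

text \<open>The order condition speaks only of a small neighbourhood of \<open>c\<close>;
  monotonicity extends its lower bound to the whole branch, by comparison with the point at distance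
  \<open>\<delta> / 2\<close> from \<open>c\<close>.\<close>

lemma order_lower_bound:
  assumes "c \<in> C" "valid_side c s"
  shows "\<exists>A>0. \<forall>x\<in>{0..1}. x \<noteq> c \<longrightarrow> s = (c < x) \<longrightarrow> closed_segment c x \<inter> C = {c} \<longrightarrow>
    A * \<bar>x - c\<bar> powr l c s \<le> \<bar>f x - v c s\<bar>"
proof -
  obtain \<delta> A where \<delta>: "\<delta> > 0" and A: "A > 0" and near: "\<And>x. x \<in> side_nbhd c s \<delta> \<inter> ({0..1} - C) \<Longrightarrow>
      A * \<bar>x - c\<bar> powr (l c s) \<le> \<bar>f x - v c s\<bar>"
    using orders[OF assms] by blast
  have l1: "1 \<le> l c s" using order_ge_1[OF assms] .
  \<comment> \<open>Far from \<open>c\<close> the power of \<open>|x - c|\<close> is at most 1, so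
    the bound \<open>A * (\<delta> / 2) powr l c s\<close> from the comparison point suffices
    there.\<close>
  define K where "K = min 1 ((\<delta> / 2) powr l c s)"
  have K: "0 < K" "K \<le> 1" "K \<le> (\<delta> / 2) powr l c s" unfolding K_def using \<delta> by auto
  have "A * K * \<bar>x - c\<bar> powr l c s \<le> \<bar>f x - v c s\<bar>"
    if x: "x \<in> {0..1}" "x \<noteq> c" "s = (c < x)" "closed_segment c x \<inter> C = {c}" for x
  proof (cases "\<bar>x - c\<bar> < \<delta>")
    case True
    have "x \<notin> C" using x(2,4) by (metis IntI ends_in_segment(2) singletonD)
    then have "x \<in> side_nbhd c s \<delta> \<inter> ({0..1} - C)"
      using True x(1-3) unfolding side_nbhd_def by auto
    then have "A * \<bar>x - c\<bar> powr (l c s) \<le> \<bar>f x - v c s\<bar>" by (rule near)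
    moreover have "A * K * \<bar>x - c\<bar> powr l c s \<le> A * \<bar>x - c\<bar> powr (l c s)"
      using K A by (intro mult_right_mono) auto
    ultimately show ?thesis by linarith
  next
    case False
    define x1 where "x1 = (if s then c + \<delta> / 2 else c - \<delta> / 2)"
    have x1: "x1 \<in> closed_segment c x" "x1 \<noteq> c" "\<bar>x1 - c\<bar> = \<delta> / 2"
      using False x(2,3) \<delta> unfolding x1_def by (auto simp: closed_segment_real_mem)
    have x1C: "x1 \<notin> C" using x1(1,2) x(4) by blast
    have "closed_segment c x \<subseteq> {0..1}"
      using assms(1) C_subset x(1) by (intro closed_segment_subset) auto
    then have "x1 \<in> side_nbhd c s \<delta> \<inter> ({0..1} - C)"
      using x1 x1C \<delta> unfolding side_nbhd_def x1_def by (auto split: if_splits)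
    then have "A * (\<delta> / 2) powr (l c s) \<le> \<bar>f x1 - v c s\<bar>" using near x1(3) by fastforce
    moreover have "f x1 \<in> closed_segment (v c (c < x)) (f x)"
      by (rule side_monotone[OF assms(1) x(1,2,4) x1(1,2)])
    then have "\<bar>f x1 - v c s\<bar> \<le> \<bar>f x - v c s\<bar>"
      using x(3) by (auto simp: closed_segment_real_mem)
    moreover have "\<bar>x - c\<bar> powr l c s \<le> 1"
    proof -
      have "\<bar>x - c\<bar> \<le> 1" using x(1) assms(1) C_subset by (auto simp: subset_iff abs_le_iff)
      then show ?thesis using powr_le1[of "l c s" "\<bar>x - c\<bar>"] l1 by simp
    qed
    then have "A * K * \<bar>x - c\<bar> powr l c s \<le> A * K * 1"
      using A K by (intro mult_left_mono) auto
    moreover have "A * K \<le> A * (\<delta> / 2) powr l c s" using A K by (intro mult_left_mono) auto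
    ultimately show ?thesis by linarith
  qed
  then show ?thesis using A K by (intro exI[of _ "A * K"]) auto
qed

text \<open>Near \<open>C\<close> this is the order condition; on the compact remainder
  \<open>Df\<close> is bounded and the distance to \<open>C\<close> is bounded below.\<close>

lemma Df_upper_bound:
  assumes "C \<noteq> {}"
  shows "\<exists>B>0. \<forall>z\<in>{0..1} - C.
    \<bar>Df z\<bar> \<le> B * \<bar>z - closest_crit C z\<bar> powr (l (closest_crit C z) (closest_crit C z < z) - 1)"
proof -
  define S where "S = {(c, s). c \<in> C \<and> valid_side c s}"
  have finS: "finite S" unfolding S_def by (rule finite_sides)
  \<comment> \<open>The single parameter \<open>e\<close> is the radius of the neighbourhood and, as
    \<open>1 / e\<close>, the bound, so one call of \<open>finite_uniform_bound\<close> makes both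
    uniform.\<close>
  have "\<exists>e>0. \<forall>e'. 0 < e' \<and> e' \<le> e \<longrightarrow> (\<forall>cs\<in>S. (\<lambda>cs e. \<forall>x \<in> side_nbhd (fst cs) (snd cs) e \<inter> ({0..1} - C).
      \<bar>Df x\<bar> \<le> (1 / e) * \<bar>x - fst cs\<bar> powr (l (fst cs) (snd cs) - 1)) cs e')"
  proof (rule finite_uniform_bound[OF finS])
    fix cs assume "cs \<in> S"
    then obtain c s where cs: "cs = (c, s)" "c \<in> C" "valid_side c s" unfolding S_def by blast
    then obtain \<delta> B where \<delta>: "\<delta> > 0" "B > 0" "\<forall>x \<in> side_nbhd c s \<delta> \<inter> ({0..1} - C).
        \<bar>Df x\<bar> \<le> B * \<bar>x - c\<bar> powr (l c s - 1)"
      using orders[of c s] by blast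
    have "\<bar>Df x\<bar> \<le> (1 / e) * \<bar>x - c\<bar> powr (l c s - 1)"
      if e: "0 < e" "e \<le> min \<delta> (1 / B)" and x: "x \<in> side_nbhd c s e \<inter> ({0..1} - C)" for x e
    proof -
      have "x \<in> side_nbhd c s \<delta> \<inter> ({0..1} - C)"
        using x e unfolding side_nbhd_def by (auto split: if_splits)
      then have "\<bar>Df x\<bar> \<le> B * \<bar>x - c\<bar> powr (l c s - 1)" using \<delta> by blast
      moreover have "B \<le> 1 / e" using e \<delta>(2) by (simp add: field_simps)
      then have "B * \<bar>x - c\<bar> powr (l c s - 1) \<le> (1 / e) * \<bar>x - c\<bar> powr (l c s - 1)"
        by (intro mult_right_mono) auto
      ultimately show ?thesis by linarith
    qed
    then show "\<exists>e>0. \<forall>e'. 0 < e' \<and> e' \<le> e \<longrightarrow> (\<forall>x \<in> side_nbhd (fst cs) (snd cs) e' \<inter> ({0..1} - C).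
      \<bar>Df x\<bar> \<le> (1 / e') * \<bar>x - fst cs\<bar> powr (l (fst cs) (snd cs) - 1))"
      unfolding cs(1) using \<delta> by (intro exI[of _ "min \<delta> (1 / B)"]) auto
  qed
  then obtain r0 where r0: "r0 > 0" "\<And>e c s x. 0 < e \<Longrightarrow> e \<le> r0 \<Longrightarrow> (c, s) \<in> S \<Longrightarrow>
      x \<in> side_nbhd c s e \<inter> ({0..1} - C) \<Longrightarrow> \<bar>Df x\<bar> \<le> (1 / e) * \<bar>x - c\<bar> powr (l c s - 1)"
    by fastforce
  define r where "r = min r0 1"
  have r: "0 < r" "r \<le> 1" "r \<le> r0" using r0 unfolding r_def by auto
  define F where "F = {0..1} \<inter> (\<Inter>c\<in>C. {z. r \<le> \<bar>z - c\<bar>})"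
  have "compact F" unfolding F_def
    by (intro compact_Int_closed closed_INT ballI closed_Collect_le continuous_intros) auto
  moreover have "F \<subseteq> {0..1} - C" unfolding F_def using r by force
  then have "continuous_on F (\<lambda>z. \<bar>Df z\<bar>)"
    using Df_continuous continuous_on_subset by (intro continuous_on_rabs) blast
  ultimately have "bounded ((\<lambda>z. \<bar>Df z\<bar>) ` F)"
    using compact_continuous_image compact_imp_bounded by blast
  then obtain B2 where B2: "B2 > 0" "\<And>z. z \<in> F \<Longrightarrow> \<bar>Df z\<bar> \<le> B2"
    unfolding bounded_pos by auto
  define LM where "LM = Max ((\<lambda>(c, s). l c s) ` (C \<times> UNIV))"
  have LM: "l c s \<le> LM" if "c \<in> C" for c s
    unfolding LM_def using finite_C that by (intro Max_ge) auto
  \<comment> \<open>The factor \<open>r powr (- LM)\<close> compensates the power of the distance: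
    since \<open>r \<le> 1\<close> and \<open>l ct s - 1 \<le> LM\<close>, the product
    \<open>r powr (- LM) * r powr (l ct s - 1)\<close> is at least 1.\<close>
  define B where "B = max (1 / r) (B2 * r powr (- LM))"
  show ?thesis
  proof (intro exI[of _ B] conjI ballI)
    show "0 < B" unfolding B_def using r by (simp add: less_max_iff_disj)
    fix z assume z: "z \<in> {0..1} - C"
    define ct where "ct = closest_crit C z"
    define s where "s = (ct < z)"
    have ct: "ct \<in> C" "\<And>c. c \<in> C \<Longrightarrow> \<bar>z - ct\<bar> \<le> \<bar>z - c\<bar>"
      unfolding ct_def using closest_crit[OF finite_C assms] by auto
    have zct: "z \<noteq> ct" using z ct by auto
    have "valid_side ct s" using z ct(1) C_subset zct unfolding s_def by (intro valid_sideI[of z]) auto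
    then have cs: "(ct, s) \<in> S" using ct unfolding S_def by auto
    have l1: "1 \<le> l ct s" using order_ge_1 cs unfolding S_def by auto
    have "\<bar>Df z\<bar> \<le> B * \<bar>z - ct\<bar> powr (l ct s - 1)"
    proof (cases "\<bar>z - ct\<bar> < r")
      case True
      then have "z \<in> side_nbhd ct s r \<inter> ({0..1} - C)"
        using z zct unfolding side_nbhd_def s_def by auto
      then have "\<bar>Df z\<bar> \<le> (1 / r) * \<bar>z - ct\<bar> powr (l ct s - 1)" using r0(2)[of r ct s z] r cs by blast
      also have "\<dots> \<le> B * \<bar>z - ct\<bar> powr (l ct s - 1)" unfolding B_def by (intro mult_right_mono) auto
      finally show ?thesis .
    next
      case False
      then have "z \<in> F" unfolding F_def using z ct(2) by force
      then have "\<bar>Df z\<bar> \<le> B2 * 1" using B2 by simp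
      also have "1 \<le> r powr (- LM) * r powr (l ct s - 1)"
      proof -
        have "r powr 0 \<le> r powr (- LM + (l ct s - 1))"
          using r LM[OF ct(1), of s] by (intro powr_mono') auto
        then show ?thesis using r by (simp only: powr_add powr_zero_eq_one) simp
      qed
      also have "r powr (- LM) * r powr (l ct s - 1) \<le> r powr (- LM) * \<bar>z - ct\<bar> powr (l ct s - 1)"
        using False r l1 by (intro mult_left_mono powr_mono2) auto
      finally have "\<bar>Df z\<bar> \<le> B2 * r powr (- LM) * \<bar>z - ct\<bar> powr (l ct s - 1)"
        using B2(1) by (simp add: mult.assoc)
      also have "\<dots> \<le> B * \<bar>z - ct\<bar> powr (l ct s - 1)" unfolding B_def by (intro mult_right_mono) auto
      finally show ?thesis .
    qed
    then show "\<bar>Df z\<bar> \<le> B * \<bar>z - closest_crit C z\<bar> powr (l (closest_crit C z) (closest_crit C z < z) - 1)"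
      unfolding ct_def s_def .
  qed
qed

section \<open>Growth of the derivative along critical orbits\<close>

definition crit_deriv :: "real \<Rightarrow> bool \<Rightarrow> nat \<Rightarrow> real" where
  "crit_deriv c s n = \<bar>iter_deriv f Df n (v c s)\<bar>"

text \<open>Both indices count from the critical value: \<open>n\<close> belongs to the point that
  the informal notation calls the image of \<open>c\<close> at time \<open>n + 1\<close>.\<close>

definition crit_dist :: "real \<Rightarrow> bool \<Rightarrow> nat \<Rightarrow> real" where
  "crit_dist c s n = \<bar>(f ^^ n) (v c s) - closest_crit C ((f ^^ n) (v c s))\<bar>"

lemma crit_deriv_pos:
  assumes "c \<in> C" "valid_side c s"
  shows "0 < crit_deriv c s n"
  unfolding crit_deriv_def using iter_deriv_nonzero[OF v_avoids[OF assms]] by auto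

lemma crit_dist_bounds:
  assumes "c \<in> C" "valid_side c s"
  shows "0 < crit_dist c s n" "crit_dist c s n \<le> 1"
    "c0 \<in> C \<Longrightarrow> crit_dist c s n \<le> \<bar>(f ^^ n) (v c s) - c0\<bar>"
proof -
  define z where "z = (f ^^ n) (v c s)"
  have z: "z \<in> {0..1}" "z \<notin> C"
    unfolding z_def using funpow_maps[OF v_unit[OF assms]] crit_orbit[OF assms] by auto
  have ne: "C \<noteq> {}" using assms by auto
  note ct = closest_crit(1)[OF finite_C ne, of z] closest_crit(2)[OF finite_C ne, of _ z]
  show "0 < crit_dist c s n" "crit_dist c s n \<le> 1"
    using z ct(1) C_subset unfolding crit_dist_def z_def[symmetric] by (auto simp: subset_iff abs_le_iff)
  show "c0 \<in> C \<Longrightarrow> crit_dist c s n \<le> \<bar>(f ^^ n) (v c s) - c0\<bar>"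
    using ct(2) unfolding crit_dist_def z_def[symmetric] by auto
qed

text \<open>With \<open>d = |f\<^sup>n(c) - c'|\<close>, where c' is the critical point closest to \<open>f\<^sup>n(c)\<close>, the order condition
  gives \<open>|Df(f\<^sup>n(c))| \<approx> d\<^bsup>l(c')-1\<^esup>\<close>. So the summand in the first summability condition is
  comparable to the power \<open>-1/l(c)\<close> of the quantity below.\<close>

lemma crit_growth:
  assumes "c \<in> C" "valid_side c s"
  shows "\<exists>k0. \<forall>n\<ge>k0. M \<le> crit_deriv c s n * crit_dist c s n powr (l c s - 1)"
proof -
  have ne: "C \<noteq> {}" using assms by auto
  obtain B where B: "B > 0" "\<And>z. z\<in>{0..1} - C \<Longrightarrow>
    \<bar>Df z\<bar> \<le> B * \<bar>z - closest_crit C z\<bar> powr (l (closest_crit C z) (closest_crit C z < z) - 1)"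
    using Df_upper_bound[OF ne] by blast
  define M' where "M' = max M 1"
  define p where "p = 1 / l c s"
  have p: "0 < p" using order_ge_1[OF assms] unfolding p_def by simp
  have "(\<lambda>n. summ1_term f Df C l c s (Suc n)) \<longlonglongrightarrow> 0"
    using summability[OF assms] by (rule summable_LIMSEQ_zero)
  \<comment> \<open>The threshold is the size that the summand would reach if the claimed lower
    bound failed; \<open>M' \<ge> 1\<close> keeps it positive.\<close>
  moreover have "0 < (1 / (B * M')) powr p" using B unfolding M'_def by simp
  ultimately have "eventually (\<lambda>n. summ1_term f Df C l c s (Suc n) < (1 / (B * M')) powr p) sequentially"
    by (rule order_tendstoD)
  then obtain k0 where k0: "\<And>n. n \<ge> k0 \<Longrightarrow> summ1_term f Df C l c s (Suc n) < (1 / (B * M')) powr p"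
    unfolding eventually_sequentially by blast
  have "M \<le> crit_deriv c s n * crit_dist c s n powr (l c s - 1)" if "n \<ge> k0" for n
  proof (rule ccontr)
    assume neg: "\<not> ?thesis"
    define y where "y = v c s"
    define z where "z = (f ^^ n) y"
    define ct where "ct = closest_crit C z"
    define d where "d = \<bar>z - ct\<bar>"
    define lt where "lt = l ct (ct < z)"
    define E where "E = crit_deriv c s n"
    define X where "X = E * d powr (l c s - 1)"
    have deq: "crit_dist c s n = d" unfolding crit_dist_def d_def ct_def z_def y_def by simp
    have d: "0 < d" using crit_dist_bounds(1)[OF assms, of n] deq by simp
    have E: "0 < E" unfolding E_def by (rule crit_deriv_pos[OF assms])
    have X: "X < M'" "0 < X" using neg d E unfolding X_def E_def[symmetric] deq M'_def by auto
    have z: "z \<in> {0..1} - C"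
      unfolding z_def y_def using funpow_maps[OF v_unit[OF assms]] crit_orbit[OF assms] by auto
    have Dz: "\<bar>Df z\<bar> \<le> B * d powr (lt - 1)" "0 < \<bar>Df z\<bar>"
      using B(2)[OF z] Df_nonzero[OF z] unfolding ct_def lt_def d_def by auto
    have summand: "summ1_term f Df C l c s (Suc n) = (d powr lt / (d powr l c s * (E * \<bar>Df z\<bar>))) powr p"
      unfolding summ1_term_def Let_def iter_deriv_Suc_last abs_mult E_def crit_deriv_def p_def
        d_def lt_def ct_def z_def y_def by simp
    \<comment> \<open>The derivative in the summand has one more factor than \<open>E\<close>,
      namely \<open>Df z\<close> at the point whose distance to \<open>C\<close> is
      \<open>d\<close>. Its bound \<open>B * d powr (lt - 1)\<close> cancels
      \<open>d powr lt\<close> up to one \<open>d\<close>, which leaves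
      \<open>1 / (B * X)\<close>.\<close>
    have "1 / (B * M') \<le> 1 / (B * X)" using X B by (intro divide_left_mono mult_left_mono) auto
    also have "\<dots> = d powr lt / (d powr l c s * (E * (B * d powr (lt - 1))))"
    proof -
      have "d powr lt = d * d powr (lt - 1)" "d powr l c s = d * d powr (l c s - 1)"
        using d by (auto simp: powr_diff)
      then show ?thesis unfolding X_def using d E B by (simp add: field_simps)
    qed
    also have "\<dots> \<le> d powr lt / (d powr l c s * (E * \<bar>Df z\<bar>))"
      using Dz d E B(1) by (intro divide_left_mono mult_left_mono mult_pos_pos) auto
    finally have "(1 / (B * M')) powr p \<le> summ1_term f Df C l c s (Suc n)"
      unfolding summand using p B(1) X by (intro powr_mono2) auto
    then show False using k0[OF that] by simp
  qed
  then show ?thesis by blast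
qed

text \<open>Since \<open>crit_dist\<close> is at most 1, \<open>crit_growth\<close> with bound 1
  gives derivative at least 1 at late times; the finitely many earlier values are positive.\<close>

lemma crit_deriv_lower:
  "\<exists>E0>0. \<forall>c\<in>C. \<forall>s. valid_side c s \<longrightarrow> (\<forall>n. E0 \<le> crit_deriv c s n)"
proof -
  define S where "S = {(c, s). c \<in> C \<and> valid_side c s}"
  have finS: "finite S" unfolding S_def by (rule finite_sides)
  have "\<exists>e>0. \<forall>e'. 0 < e' \<and> e' \<le> e \<longrightarrow> (\<forall>cs\<in>S. (\<lambda>cs e. \<forall>n. e \<le> crit_deriv (fst cs) (snd cs) n) cs e')"
  proof (rule finite_uniform_bound[OF finS])
    fix cs assume "cs \<in> S"
    then obtain c s where cs: "cs = (c, s)" "c \<in> C" "valid_side c s" unfolding S_def by blast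
    obtain k0 where k0: "\<And>n. n \<ge> k0 \<Longrightarrow> 1 \<le> crit_deriv c s n * crit_dist c s n powr (l c s - 1)"
      using crit_growth[OF cs(2,3)] by blast
    have big: "1 \<le> crit_deriv c s n" if "n \<ge> k0" for n
    proof -
      have "crit_dist c s n powr (l c s - 1) \<le> 1"
        using crit_dist_bounds[OF cs(2,3), of n] order_ge_1[OF cs(2,3)] by (intro powr_le1) auto
      then have "crit_deriv c s n * crit_dist c s n powr (l c s - 1) \<le> crit_deriv c s n * 1"
        using crit_deriv_pos[OF cs(2,3), of n] by (intro mult_left_mono) auto
      then show ?thesis using k0[OF that] by linarith
    qed
    define e where "e = Min (insert 1 (crit_deriv c s ` {..<k0}))"
    have "0 < e" unfolding e_def using crit_deriv_pos[OF cs(2,3)] by (subst Min_gr_iff) auto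
    moreover have "e \<le> crit_deriv c s n" for n
    proof (cases "n < k0")
      case True then show ?thesis unfolding e_def by (intro Min_le) auto
    next
      case False
      have "e \<le> 1" unfolding e_def by (intro Min_le) auto
      then show ?thesis using big[of n] False by linarith
    qed
    ultimately show "\<exists>e>0. \<forall>e'. 0 < e' \<and> e' \<le> e \<longrightarrow> (\<forall>n. e' \<le> crit_deriv (fst cs) (snd cs) n)"
      unfolding cs(1) by (intro exI[of _ e]) (auto intro: order.trans)
  qed
  then obtain e where "e > 0" "\<forall>cs\<in>S. \<forall>n. e \<le> crit_deriv (fst cs) (snd cs) n" by blast
  then show ?thesis unfolding S_def by (intro exI[of _ e]) auto
qed

text \<open>The first \<open>k0\<close> points of a critical orbit have positive distance from
  \<open>C\<close>, so a point within \<open>\<delta>\<close> of \<open>C\<close> comes late, where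
  \<open>crit_growth\<close> applies; then the distance is replaced by the larger
  \<open>\<delta>\<close>.\<close>

lemma crit_deriv_close:
  fixes M :: "real \<Rightarrow> bool \<Rightarrow> real"
  shows "\<exists>r>0. \<forall>\<delta>. 0 < \<delta> \<and> \<delta> \<le> r \<longrightarrow> (\<forall>c\<in>C. \<forall>s. valid_side c s \<longrightarrow>
     (\<forall>n. \<forall>c0\<in>C. \<bar>(f ^^ n) (v c s) - c0\<bar> \<le> \<delta> \<longrightarrow> M c s \<le> crit_deriv c s n * \<delta> powr (l c s - 1)))"
proof -
  define S where "S = {(c, s). c \<in> C \<and> valid_side c s}"
  have finS: "finite S" unfolding S_def by (rule finite_sides)
  have "\<exists>e>0. \<forall>e'. 0 < e' \<and> e' \<le> e \<longrightarrow> (\<forall>cs\<in>S. (\<lambda>cs \<delta>. \<forall>n. \<forall>c0\<in>C.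
     \<bar>(f ^^ n) (v (fst cs) (snd cs)) - c0\<bar> \<le> \<delta> \<longrightarrow> M (fst cs) (snd cs) \<le> crit_deriv (fst cs) (snd cs) n * \<delta> powr (l (fst cs) (snd cs) - 1)) cs e')"
  proof (rule finite_uniform_bound[OF finS])
    fix cs assume "cs \<in> S"
    then obtain c s where cs: "cs = (c, s)" "c \<in> C" "valid_side c s" unfolding S_def by blast
    obtain k0 where k0: "\<And>n. n \<ge> k0 \<Longrightarrow> M c s \<le> crit_deriv c s n * crit_dist c s n powr (l c s - 1)"
      using crit_growth[OF cs(2,3)] by blast
    define e where "e = Min (insert 1 (crit_dist c s ` {..<k0})) / 2"
    have e0: "0 < e" unfolding e_def using crit_dist_bounds(1)[OF cs(2,3)] by auto
    have small: "e < crit_dist c s n" if "n < k0" for n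
    proof -
      have "2 * e \<le> crit_dist c s n" unfolding e_def using that by (auto intro: Min_le)
      then show ?thesis using e0 by linarith
    qed
    have "M c s \<le> crit_deriv c s n * \<delta> powr (l c s - 1)"
      if \<delta>: "0 < \<delta>" "\<delta> \<le> e" and c0: "c0 \<in> C" "\<bar>(f ^^ n) (v c s) - c0\<bar> \<le> \<delta>" for \<delta> n c0
    proof -
      have dd: "crit_dist c s n \<le> \<delta>" using crit_dist_bounds(3)[OF cs(2,3) c0(1), of n] c0(2) by linarith
      then have "n \<ge> k0" using small[of n] \<delta> by linarith
      then have "M c s \<le> crit_deriv c s n * crit_dist c s n powr (l c s - 1)" by (rule k0)
      also have "\<dots> \<le> crit_deriv c s n * \<delta> powr (l c s - 1)"
        using dd crit_dist_bounds(1)[OF cs(2,3), of n] order_ge_1[OF cs(2,3)] crit_deriv_pos[OF cs(2,3), of n]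
        by (intro mult_left_mono powr_mono2) auto
      finally show ?thesis .
    qed
    then show "\<exists>e>0. \<forall>e'. 0 < e' \<and> e' \<le> e \<longrightarrow> (\<forall>n. \<forall>c0\<in>C.
     \<bar>(f ^^ n) (v (fst cs) (snd cs)) - c0\<bar> \<le> e' \<longrightarrow> M (fst cs) (snd cs) \<le> crit_deriv (fst cs) (snd cs) n * e' powr (l (fst cs) (snd cs) - 1))"
      unfolding cs(1) using e0 by (intro exI[of _ e]) auto
  qed
  then obtain e where "e > 0" "\<forall>e'. 0 < e' \<and> e' \<le> e \<longrightarrow> (\<forall>cs\<in>S. \<forall>n. \<forall>c0\<in>C.
     \<bar>(f ^^ n) (v (fst cs) (snd cs)) - c0\<bar> \<le> e' \<longrightarrow> M (fst cs) (snd cs) \<le> crit_deriv (fst cs) (snd cs) n * e' powr (l (fst cs) (snd cs) - 1))"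
    by blast
  then show ?thesis unfolding S_def by (intro exI[of _ e]) auto
qed

end

section \<open>Homtervals\<close>

context interval_map
begin

lemma homterval_subset: "homterval I \<Longrightarrow> K \<subseteq> I \<Longrightarrow> homterval K"
  unfolding homterval_def using avoids_subset by blast

lemma homterval_Un: "homterval I \<Longrightarrow> homterval K \<Longrightarrow> homterval (I \<union> K)"
  unfolding homterval_def using avoids_Un by blast

lemma homterval_iff: "homterval I \<longleftrightarrow> I \<subseteq> {0..1} \<and> (\<forall>n. (f ^^ n) ` I \<inter> C = {})"
  unfolding homterval_def avoids_def by blast

lemma homterval_point:
  assumes "homterval I" "x \<in> I"
  shows "(f ^^ n) x \<in> {0..1}" "(f ^^ n) x \<notin> C"
  using assms funpow_maps unfolding homterval_iff by blast+

lemma homterval_image: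
  assumes "homterval I"
  shows "homterval ((f ^^ n) ` I)"
proof -
  have "(f ^^ k) ` (f ^^ n) ` I \<inter> C = {}" for k
    using assms unfolding homterval_iff image_comp funpow_add[symmetric] by blast
  then show ?thesis using assms funpow_maps unfolding homterval_iff by blast
qed

lemma is_interval_homterval_image:
  assumes "homterval I" "is_interval I"
  shows "is_interval ((f ^^ n) ` I)"
  using assms iterate_regular connected_continuous_image is_interval_connected_1
  unfolding homterval_def by metis

lemma tendsto_f_off_C:
  assumes "w \<longlonglongrightarrow> q" "q \<in> {0..1} - C" "\<And>j. w j \<in> {0..1}"
  shows "(\<lambda>j. f (w j)) \<longlonglongrightarrow> f q"
  using continuous_within_tendsto_compose'[OF continuous_off_C[OF assms(2)]] assms(1,3) by blast

lemma homterval_returning_point: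
  assumes I: "homterval I" "is_interval I" and x: "x \<in> I" and p: "0 < p" "(f ^^ p) x \<in> I"
  shows "\<exists>Orb. periodic_orbit f Orb \<and> x \<in> basin f Orb"
proof -
  define A where "A j = (f ^^ (j * p)) ` I" for j
  \<comment> \<open>Consecutive images overlap in a point of the orbit of \<open>x\<close>, so
    \<open>U\<close> is an interval. It is a homterval mapped into itself by \<open>f ^^ p\<close>,
    and on it all iterates are monotone.\<close>
  define U where "U = (\<Union>j. A j)"
  have A0: "A 0 = I" unfolding A_def by simp
  have conA: "connected (A j)" for j
    unfolding A_def using is_interval_homterval_image[OF I] is_interval_connected by blast
  have link: "A n \<inter> A (Suc n) \<noteq> {}" for n
  proof -
    have "(f ^^ (n * p)) ((f ^^ p) x) \<in> A n" unfolding A_def using p by blast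
    moreover have "(f ^^ (n * p)) ((f ^^ p) x) = (f ^^ (Suc n * p)) x"
      by (simp add: funpow_add[symmetric, THEN fun_cong, unfolded o_apply] add.commute)
    ultimately show ?thesis unfolding A_def using x by blast
  qed
  have conV: "connected (\<Union>j\<le>n. A j)" for n
  proof (induction n)
    case 0 then show ?case using conA[of 0] by simp
  next
    case (Suc n)
    have "(\<Union>j\<le>Suc n. A j) = (\<Union>j\<le>n. A j) \<union> A (Suc n)" by (auto simp: atMost_Suc)
    moreover have "(\<Union>j\<le>n. A j) \<inter> A (Suc n) \<noteq> {}" using link[of n] by blast
    ultimately show ?case using connected_Un[OF Suc conA] by simp
  qed
  have "U = \<Union>(range (\<lambda>n. \<Union>j\<le>n. A j))" unfolding U_def by auto
  moreover have "connected (\<Union>(range (\<lambda>n. \<Union>j\<le>n. A j)))"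
  proof (rule connected_Union)
    show "\<Inter> (range (\<lambda>n. \<Union>j\<le>n. A j)) \<noteq> {}" using x A0 by blast
  qed (use conV in auto)
  ultimately have intU: "is_interval U" by (simp add: is_interval_connected_1)
  have homU: "homterval U"
    using homterval_image[OF I(1)] unfolding U_def A_def homterval_iff by blast
  have pU: "(f ^^ p) y \<in> U" if y: "y \<in> U" for y
  proof -
    obtain j t where jt: "t \<in> I" "y = (f ^^ (j * p)) t" using y unfolding U_def A_def by blast
    have "(f ^^ p) y = (f ^^ (Suc j * p)) t" using jt by (simp add: funpow_add)
    then show ?thesis unfolding U_def A_def using jt by blast
  qed
  have mono: "strictly_monotone_on U (f ^^ n)" for n
    using iterate_regular[OF intU] homU unfolding homterval_def by blast
  \<comment> \<open>\<open>f ^^ p\<close> may reverse orientation on \<open>U\<close>; its square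
    preserves it, which makes the orbit of \<open>x\<close> under \<open>f ^^ T\<close>
    monotone.\<close>
  define T where "T = 2 * p"
  have T: "0 < T" using p unfolding T_def by simp
  have TU: "(f ^^ T) y = (f ^^ p) ((f ^^ p) y)" for y unfolding T_def by (simp add: funpow_add mult_2)
  have incT: "(f ^^ T) y \<le> (f ^^ T) z" if "y \<in> U" "z \<in> U" "y \<le> z" for y z
    using mono[of p] pU that unfolding TU strictly_monotone_on_def
    by (metis order.order_iff_strict)
  define y where "y j = (f ^^ (j * T)) x" for j
  have ySuc: "y (Suc j) = (f ^^ T) (y j)" for j unfolding y_def by (simp add: funpow_add)
  have yU: "y j \<in> U" for j
  proof (induction j)
    case 0 then show ?case using x A0 unfolding y_def U_def by auto
  next
    case (Suc j) then show ?case unfolding ySuc TU using pU by blast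
  qed
  have ymono: "(\<forall>j. y j \<le> y (Suc j)) \<or> (\<forall>j. y (Suc j) \<le> y j)"
  proof (cases "y 0 \<le> y 1")
    case True
    have "y j \<le> y (Suc j)" for j
    proof (induction j)
      case (Suc j)
      then show ?case using incT[OF yU yU] ySuc by metis
    qed (use True in simp)
    then show ?thesis by blast
  next
    case False
    have "y (Suc j) \<le> y j" for j
    proof (induction j)
      case (Suc j)
      then show ?case using incT[OF yU yU] ySuc by metis
    qed (use False in simp)
    then show ?thesis by blast
  qed
  \<comment> \<open>One subsequence of the orbit for each phase \<open>s\<close>; monotonicity of
    \<open>f ^^ s\<close> on \<open>U\<close> makes each of them convergent.\<close>
  define w where "w s j = (f ^^ s) (y j)" for s j
  have weq: "w s j = (f ^^ (j * T + s)) x" for s j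
    unfolding w_def y_def by (simp add: funpow_add[symmetric, THEN fun_cong, unfolded o_apply] add.commute)
  have w01: "w s j \<in> {0..1}" and wC: "w s j \<notin> C" for s j
    using yU homU funpow_maps unfolding w_def homterval_iff by blast+
  have wmono: "incseq (w s) \<or> decseq (w s)" for s
    using ymono mono[of s] yU unfolding strictly_monotone_on_def incseq_Suc_iff decseq_Suc_iff w_def
    by (metis order.order_iff_strict)
  have "\<exists>q. w s \<longlonglongrightarrow> q" for s
  proof -
    have "Bseq (w s)" using w01 by (intro BseqI'[of _ 1]) auto
    moreover have "monoseq (w s)" using wmono monoseq_iff by blast
    ultimately show ?thesis using Bseq_monoseq_convergent convergent_def by blast
  qed
  then obtain q where q: "\<And>s. w s \<longlonglongrightarrow> q s" by metis
  have q01: "q s \<in> {0..1}" for s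
    using q[of s] w01 by (meson closed_real_atLeastAtMost closed_sequentially)
  have qT: "q (s + T) = q s" for s
  proof -
    have "w (s + T) j = w s (Suc j)" for j unfolding weq by (simp add: algebra_simps)
    then have "w (s + T) \<longlonglongrightarrow> q s" using LIMSEQ_Suc[OF q[of s]] by presburger
    then show ?thesis using LIMSEQ_unique[OF q] by blast
  qed
  have wf: "w (Suc s) = (\<lambda>j. f (w s j))" for s unfolding w_def by simp
  \<comment> \<open>Continuity may fail at points of \<open>C\<close>. A phase tending to
    \<open>c\<close> in \<open>C\<close> does so from one side, hence later phases tend to the
    points of that critical orbit; phase \<open>s + T\<close> has the same limit as phase
    \<open>s\<close>, so the critical orbit would contain \<open>c\<close>.\<close>
  have qC: "q s \<notin> C" for s
  proof
    assume c: "q s \<in> C"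
    define c where "c = q s"
    obtain b where vb: "valid_side c b" and lim: "filterlim (w s) (side_filter c b) sequentially"
    proof -
      have ne: "w s j \<noteq> c" for j using wC c unfolding c_def by metis
      from wmono[of s] show ?thesis
      proof
        assume "incseq (w s)"
        then have lt: "w s j < c" for j
          using incseq_le[OF _ q[of s]] ne unfolding c_def by (simp add: order.strict_iff_order)
        have "filterlim (w s) (at_left c) sequentially"
          using q[of s] lt ne unfolding filterlim_at c_def by auto
        moreover have "0 < c" using lt[of 0] w01[of s 0] by auto
        ultimately show ?thesis using that[of False] unfolding valid_side_def side_filter_def by simp
      next
        assume "decseq (w s)"
        then have gt: "c < w s j" for j
          using decseq_ge[OF _ q[of s]] ne unfolding c_def by (metis order.order_iff_strict)
        have "filterlim (w s) (at_right c) sequentially"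
          using q[of s] gt ne unfolding filterlim_at c_def by auto
        moreover have "c < 1" using gt[of 0] w01[of s 0] by auto
        ultimately show ?thesis using that[of True] unfolding valid_side_def side_filter_def by simp
      qed
    qed
    have cC: "c \<in> C" using c c_def by simp
    have "w (Suc s + k) \<longlonglongrightarrow> (f ^^ k) (v c b)" for k
    proof (induction k)
      case 0
      show ?case using filterlim_compose[OF tendsto_v[OF cC vb] lim] wf by simp
    next
      case (Suc k)
      have "(\<lambda>j. f (w (Suc s + k) j)) \<longlonglongrightarrow> f ((f ^^ k) (v c b))"
        using Suc crit_orbit[OF cC vb] funpow_maps[OF v_unit[OF cC vb]] w01
        by (intro tendsto_f_off_C) auto
      then show ?case using wf[of "Suc s + k"] by simp
    qed
    then have "q (Suc s + (T - 1)) = (f ^^ (T - 1)) (v c b)" using LIMSEQ_unique[OF q] by blast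
    moreover have "Suc s + (T - 1) = s + T" using T by simp
    ultimately have "(f ^^ (T - 1)) (v c b) \<in> C" using qT cC c_def by simp
    then show False using crit_orbit[OF cC vb] by blast
  qed
  have qSuc: "q (Suc s) = f (q s)" for s
  proof -
    have "w (Suc s) \<longlonglongrightarrow> f (q s)"
      using tendsto_f_off_C[OF q[of s]] q01 qC w01 unfolding wf by simp
    then show ?thesis using LIMSEQ_unique[OF q] by blast
  qed
  have qpow: "q s = (f ^^ s) (q 0)" for s by (induction s) (use qSuc in auto)
  have qmod: "q (j * T + s) = q s" for j s
    by (induction j) (use qT in \<open>auto simp: algebra_simps\<close>, metis add.assoc add.commute)
  define Orb where "Orb = {(f ^^ i) (q 0) | i. i < T}"
  have "periodic_orbit f Orb"
    unfolding periodic_orbit_def Orb_def using q01 T qpow[of T] qT[of 0] by auto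
  moreover have "x \<in> basin f Orb"
  proof -
    have qOrb: "q n \<in> Orb" for n
    proof -
      have "q n = q (n mod T)" using qmod[of "n div T" "n mod T"] by simp
      moreover have "q (n mod T) \<in> Orb"
        unfolding Orb_def using qpow[of "n mod T"] mod_less_divisor[OF T, of n] by blast
      ultimately show ?thesis by simp
    qed
    have "(\<lambda>n. infdist ((f ^^ n) x) Orb) \<longlonglongrightarrow> 0"
    proof (rule LIMSEQ_I)
      fix e :: real assume e: "0 < e"
      have "\<exists>J. \<forall>j\<ge>J. \<bar>w s j - q s\<bar> < e" for s
        using LIMSEQ_D[OF q[of s] e] by auto
      then obtain J where J: "\<And>s j. j \<ge> J s \<Longrightarrow> \<bar>w s j - q s\<bar> < e" by metis
      define JJ where "JJ = Max (J ` {..<T})"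
      have JJ: "J s \<le> JJ" if "s < T" for s unfolding JJ_def using that by (intro Max_ge) auto
      have "norm (infdist ((f ^^ n) x) Orb - 0) < e" if n: "n \<ge> JJ * T" for n
      proof -
        define s j where "s = n mod T" and "j = n div T"
        have nj: "n = j * T + s" unfolding s_def j_def by simp
        have "s < T" unfolding s_def using T by simp
        moreover have "JJ \<le> j" unfolding j_def using n T by (simp add: less_eq_div_iff_mult_less_eq)
        ultimately have "\<bar>w s j - q s\<bar> < e" using J JJ order.trans by blast
        moreover have "infdist ((f ^^ n) x) Orb \<le> dist ((f ^^ n) x) (q s)"
          using qOrb by (intro infdist_le)
        ultimately show ?thesis unfolding nj weq by (simp add: dist_real_def infdist_nonneg)
      qed
      then show "\<exists>no. \<forall>n\<ge>no. norm (infdist ((f ^^ n) x) Orb - 0) < e" by blast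
    qed
    then show ?thesis unfolding basin_def using x I(1) unfolding homterval_iff by blast
  qed
  ultimately show ?thesis by blast
qed

section \<open>Maximal branches and inverse images of their end points\<close>

lemma end_of_branch:
  assumes "a \<in> {0..1}" "b \<in> {0..1}" "a \<noteq> b" "closed_segment a b \<inter> C = {}"
  shows "\<exists>z\<in>{0..1}. a \<in> closed_segment z b \<and>
    (z \<in> {0, 1} \<and> closed_segment z b \<inter> C = {} \<or> z \<in> C \<and> closed_segment z b \<inter> C = {z})"
proof -
  have abC: "a \<notin> C" "b \<notin> C" using assms(4) by auto
  have fin: "finite (C \<inter> S)" for S using finite_C by blast
  show ?thesis
  proof (cases "a < b")
    case True
    have noC: "c < a \<or> b < c" if "c \<in> C" for c
    proof (rule ccontr)
      assume "\<not> ?thesis"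
      then have "c \<in> closed_segment a b" by (auto simp: closed_segment_real_mem)
      then show False using assms(4) that by blast
    qed
    show ?thesis
    proof (cases "C \<inter> {..a} = {}")
      case empty: True
      have "c \<notin> C" if "c \<in> closed_segment 0 b" for c
      proof
        assume c: "c \<in> C"
        then have "\<not> c \<le> a" using empty by auto
        then show False using noC[OF c] that assms(2) by (auto simp: closed_segment_real_mem)
      qed
      then have "closed_segment 0 b \<inter> C = {}" by blast
      then show ?thesis using assms(1,2) True
        by (intro bexI[of _ 0]) (auto simp: closed_segment_real_mem)
    next
      case False
      \<comment> \<open>The last point of \<open>C\<close> before \<open>a\<close>, where the
        monotone branch containing \<open>a\<close> and \<open>b\<close> ends; the other orientation
        uses the first one after \<open>a\<close>.\<close>
      define z where "z = Max (C \<inter> {..a})"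
      have z: "z \<in> C" "z \<le> a" "\<And>c. c \<in> C \<Longrightarrow> c \<le> a \<Longrightarrow> c \<le> z"
        using Max_in[OF fin False] Max_ge[OF fin, of _ "{..a}"] unfolding z_def by auto
      have "c = z" if "c \<in> closed_segment z b" "c \<in> C" for c
        using noC[OF that(2)] z(2) z(3)[OF that(2)] that(1) True by (auto simp: closed_segment_real_mem)
      then have "closed_segment z b \<inter> C = {z}" using z(1) by auto
      then show ?thesis using z True C_subset
        by (intro bexI[of _ z]) (auto simp: closed_segment_real_mem)
    qed
  next
    case False
    then have ba: "b < a" using assms(3) by simp
    have noC: "a < c \<or> c < b" if "c \<in> C" for c
    proof (rule ccontr)
      assume "\<not> ?thesis"
      then have "c \<in> closed_segment a b" by (auto simp: closed_segment_real_mem)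
      then show False using assms(4) that by blast
    qed
    show ?thesis
    proof (cases "C \<inter> {a..} = {}")
      case empty: True
      have "c \<notin> C" if "c \<in> closed_segment 1 b" for c
      proof
        assume c: "c \<in> C"
        then have "\<not> a \<le> c" using empty by auto
        then show False using noC[OF c] that assms(2) by (auto simp: closed_segment_real_mem)
      qed
      then have "closed_segment 1 b \<inter> C = {}" by blast
      then show ?thesis using assms(1,2) ba
        by (intro bexI[of _ 1]) (auto simp: closed_segment_real_mem)
    next
      case False
      define z where "z = Min (C \<inter> {a..})"
      have z: "z \<in> C" "a \<le> z" "\<And>c. c \<in> C \<Longrightarrow> a \<le> c \<Longrightarrow> z \<le> c"
        using Min_in[OF fin False] Min_le[OF fin, of _ "{a..}"] unfolding z_def by auto
      have "c = z" if "c \<in> closed_segment z b" "c \<in> C" for c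
        using noC[OF that(2)] z(2) z(3)[OF that(2)] that(1) ba by (auto simp: closed_segment_real_mem)
      then have "closed_segment z b \<inter> C = {z}" using z(1) by auto
      then show ?thesis using z ba C_subset
        by (intro bexI[of _ z]) (auto simp: closed_segment_real_mem)
    qed
  qed
qed

text \<open>Let \<open>t\<close> move away from \<open>a\<close> along the branch. By monotonicity
  either \<open>P\<close> is attained or \<open>f t\<close> stays between \<open>P\<close> and
  \<open>f a\<close> (fact \<open>reach\<close>). In the second case the branch ends at the boundary
  of M or at a critical point, and there the estimate passes to the one-sided limit.\<close>

lemma pull_back_endpoint:
  assumes ab: "a \<in> {0..1}" "b \<in> {0..1}" "a \<noteq> b" "closed_segment a b \<inter> C = {}"
    and P: "f a \<in> closed_segment P (f b)"
  obtains (exact) p where "p \<in> {0..1}" "a \<in> closed_segment p b" "closed_segment p b \<inter> C = {}" "f p = P"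
  | (boundary) p where "p \<in> {0, 1}" "a \<in> closed_segment p b" "closed_segment p b \<inter> C = {}"
      "f p \<in> closed_segment P (f a)"
  | (critical) c where "c \<in> C" "a \<in> closed_segment c b" "closed_segment c b \<inter> C = {c}"
      "v c (c < b) \<in> closed_segment P (f a)"
proof -
  have reach: "(\<exists>p\<in>{0..1}. a \<in> closed_segment p b \<and> closed_segment p b \<inter> C = {} \<and> f p = P)
      \<or> f t \<in> closed_segment P (f a)"
    if t: "t \<in> {0..1}" "a \<in> closed_segment t b" "closed_segment t b \<inter> C = {}" for t
  proof -
    have sub: "closed_segment t b \<subseteq> {0..1} - C"
      using t(3) closed_segment_subset[OF t(1) ab(2)] by auto
    have mono: "strictly_monotone_on (closed_segment t b) f"
      by (rule strictly_monotone_f[OF is_interval_closed_segment_real sub])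
    have "f a \<in> closed_segment (f t) (f b)"
      using strictly_monotone_on_segment[OF mono _ _ t(2) t(2)] by simp
    moreover have "f a \<noteq> f b"
      using strictly_monotone_on_inj[OF mono] t(2) ab(3) by (auto simp: inj_on_def)
    ultimately have "P \<in> closed_segment (f t) (f a) \<or> f t \<in> closed_segment P (f a)"
      using P by (auto simp: closed_segment_real_mem)
    moreover have "\<exists>p\<in>{0..1}. a \<in> closed_segment p b \<and> closed_segment p b \<inter> C = {} \<and> f p = P"
      if Pt: "P \<in> closed_segment (f t) (f a)"
    proof -
      have sub2: "closed_segment t a \<subseteq> closed_segment t b"
        using t(2) by (intro closed_segment_subset) auto
      have "f ` closed_segment t a = closed_segment (f t) (f a)"
        using strictly_monotone_on_subset[OF mono sub2] continuous_on_off_C sub sub2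
        by (intro strictly_monotone_image_segment) auto
      then obtain p where p: "p \<in> closed_segment t a" "f p = P" using Pt by (metis imageE)
      have "closed_segment p b \<subseteq> closed_segment t b"
        using p(1) sub2 by (intro closed_segment_subset) auto
      moreover have "a \<in> closed_segment p b" using p(1) t(2) by (auto simp: closed_segment_real_mem)
      ultimately show ?thesis using p sub sub2 t(3) by blast
    qed
    ultimately show ?thesis by blast
  qed
  obtain z where z: "z \<in> {0..1}" "a \<in> closed_segment z b"
    "z \<in> {0, 1} \<and> closed_segment z b \<inter> C = {} \<or> z \<in> C \<and> closed_segment z b \<inter> C = {z}"
    using end_of_branch[OF ab] by blast
  show ?thesis
  proof (cases "\<exists>p\<in>{0..1}. a \<in> closed_segment p b \<and> closed_segment p b \<inter> C = {} \<and> f p = P")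
    case True
    then show ?thesis using exact by blast
  next
    case False
    from z(3) show ?thesis
    proof
      assume "z \<in> {0, 1} \<and> closed_segment z b \<inter> C = {}"
      then show ?thesis using reach[OF z(1,2)] False boundary[OF _ z(2)] by blast
    next
      assume zC: "z \<in> C \<and> closed_segment z b \<inter> C = {z}"
      have az: "a \<noteq> z" using zC ab(4) by auto
      have bz: "(z < b) = (z < a)" using az z(2) ab(3) by (auto simp: closed_segment_real_mem)
      have "f t \<in> closed_segment P (f a)" if "t \<in> closed_segment z a - {z}" for t
      proof -
        have "closed_segment z a \<subseteq> {0..1}" using z(1) ab(1) by (intro closed_segment_subset) auto
        then have "t \<in> {0..1}" using that by blast
        moreover have "a \<in> closed_segment t b" using that z(2) by (auto simp: closed_segment_real_mem)
        moreover have "closed_segment t b \<subseteq> closed_segment z b - {z}"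
          using that z(2) ab(3) by (auto simp: closed_segment_real_mem)
        then have "closed_segment t b \<inter> C = {}" using zC by blast
        ultimately show ?thesis using reach False by blast
      qed
      then have "v z (z < a) \<in> closed_segment P (f a)"
        using zC ab(1) az by (intro v_limit_closed) auto
      then show ?thesis using critical[of z] zC z(2) bz by simp
    qed
  qed
qed

end

section \<open>Pulling back collars\<close>

text \<open>What is kept of a wandering interval after passing to a late iterate: the orbit of one
  of its points. Both assumptions speak of arbitrary homtervals, so they remain available after
  every thickening.\<close>

locale wandering_point = interval_map +
  fixes x0 :: real
  assumes no_return: "homterval I \<Longrightarrow> is_interval I \<Longrightarrow> (f ^^ n) x0 \<in> I \<Longrightarrow> (f ^^ m) x0 \<in> I \<Longrightarrow> n = m"
    and no_boundary: "homterval I \<Longrightarrow> is_interval I \<Longrightarrow> (f ^^ n) x0 \<in> I \<Longrightarrow> 0 \<notin> I \<and> 1 \<notin> I"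
begin

text \<open>If two images met, their union would be a homterval and an interval with two orbit
  points of \<open>x0\<close>, against \<open>no_return\<close>; disjointness gives the
  limit.\<close>

lemma homterval_lengths:
  assumes "homterval {a..b}" "x0 \<in> {a..b}"
  shows "(\<lambda>n. \<bar>(f ^^ n) a - (f ^^ n) b\<bar>) \<longlonglongrightarrow> 0"
proof -
  have ab: "a \<le> b" "{a..b} = closed_segment a b" using assms(2) by (auto simp: closed_segment_eq_real_ivl)
  have seg: "closed_segment ((f ^^ n) a) ((f ^^ n) b) = (f ^^ n) ` {a..b}" for n
    using iterate_image_segment[of n a b] assms(1) unfolding ab(2) homterval_def by auto
  show ?thesis
  proof (rule disjoint_segments_shrink)
    show "(f ^^ n) a \<in> {0..1}" "(f ^^ n) b \<in> {0..1}" for n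
      using assms(1) ab(1) funpow_maps[of a n] funpow_maps[of b n] unfolding homterval_iff by auto
    fix m n :: nat assume mn: "m \<noteq> n"
    show "closed_segment ((f ^^ m) a) ((f ^^ m) b) \<inter> closed_segment ((f ^^ n) a) ((f ^^ n) b) = {}"
    proof (rule ccontr)
      assume ne: "\<not> ?thesis"
      define I where "I = (f ^^ m) ` {a..b} \<union> (f ^^ n) ` {a..b}"
      have "homterval I" unfolding I_def by (intro homterval_Un homterval_image assms(1))
      moreover have "connected I"
        unfolding I_def using ne seg is_interval_homterval_image[OF assms(1) is_interval_cc]
        by (intro connected_Un) (auto simp: is_interval_connected_1)
      moreover have "(f ^^ m) x0 \<in> I" "(f ^^ n) x0 \<in> I" unfolding I_def using assms(2) by auto
      ultimately show False using no_return[of I m n] mn by (simp add: is_interval_connected_1)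
    qed
  qed
qed

text \<open>Meant for the case that one collar contains the critical value \<open>v c s\<close>
  while the opposite one is cut off at \<open>e\<close>. The segment between them then contains an
  iterate of \<open>x0\<close>, and its image would be shorter than \<open>r\<close>.\<close>

definition boundary_separation :: "real \<Rightarrow> bool" where
  "boundary_separation r \<longleftrightarrow> (\<forall>e\<in>{0, 1}. \<forall>c\<in>C. \<forall>s. valid_side c s \<longrightarrow> (\<forall>n i. e \<noteq> v c s \<longrightarrow>
     avoids n (closed_segment e (v c s)) \<longrightarrow> (f ^^ i) x0 \<in> closed_segment e (v c s) \<longrightarrow>
     r \<le> \<bar>(f ^^ n) e - (f ^^ n) (v c s)\<bar>))"

lemma boundary_separation_mono:
  "boundary_separation r \<Longrightarrow> r' \<le> r \<Longrightarrow> boundary_separation r'"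
  unfolding boundary_separation_def by (meson order.trans)

text \<open>The segment contains a boundary point and an iterate of \<open>x0\<close>, so by
  \<open>no_boundary\<close> it is no homterval. Hence only finitely many \<open>n\<close> occur for
  it, and for each of them \<open>f ^^ n\<close> separates the end points.\<close>

lemma boundary_separation_exists: "\<exists>r>0. boundary_separation r"
proof -
  define S where "S = {0, 1::real} \<times> {(c, s). c \<in> C \<and> valid_side c s}"
  have finS: "finite S" unfolding S_def using finite_sides by blast
  define P where "P = (\<lambda>(e, c, s) r. \<forall>n i. e \<noteq> v c s \<longrightarrow>
     avoids n (closed_segment e (v c s)) \<longrightarrow> (f ^^ i) x0 \<in> closed_segment e (v c s) \<longrightarrow>
     r \<le> \<bar>(f ^^ n) e - (f ^^ n) (v c s)\<bar>)"
  have "\<exists>r>0. \<forall>r'. 0 < r' \<and> r' \<le> r \<longrightarrow> (\<forall>x\<in>S. P x r')"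
  proof (rule finite_uniform_bound[OF finS])
    fix x assume "x \<in> S"
    then obtain e c s where x: "x = (e, c, s)" "e \<in> {0, 1}" "c \<in> C" "valid_side c s"
      unfolding S_def by blast
    define I where "I = closed_segment e (v c s)"
    show "\<exists>r>0. \<forall>r'. 0 < r' \<and> r' \<le> r \<longrightarrow> P x r'"
    proof (cases "e \<noteq> v c s \<and> (\<exists>i. (f ^^ i) x0 \<in> I)")
      case False
      then show ?thesis unfolding P_def x(1) I_def by (intro exI[of _ 1]) auto
    next
      case True
      then obtain i where i: "(f ^^ i) x0 \<in> I" by blast
      have "e \<in> I" unfolding I_def by simp
      then have "\<not> homterval I"
        using no_boundary[of I i] i x(2) unfolding I_def by (auto simp: is_interval_closed_segment_real)
      then obtain n1 where n1: "\<not> avoids n1 I" unfolding homterval_def by blast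
      define Q where "Q = (\<lambda>n. \<bar>(f ^^ n) e - (f ^^ n) (v c s)\<bar>) ` {n. n < n1 \<and> avoids n I}"
      have finQ: "finite (insert 1 Q)" unfolding Q_def by simp
      have Qpos: "0 < y" if "y \<in> insert 1 Q" for y
        using that True iterate_inj[OF _ is_interval_closed_segment_real, of _ e "v c s"]
        unfolding Q_def I_def by (auto simp: inj_on_def)
      define r where "r = Min (insert 1 Q)"
      have "0 < r" unfolding r_def using Qpos finQ by (subst Min_gr_iff) auto
      moreover have "r \<le> \<bar>(f ^^ n) e - (f ^^ n) (v c s)\<bar>" if "avoids n I" for n
      proof -
        have "n < n1" using that n1 avoids_mono linorder_not_le by blast
        then show ?thesis unfolding r_def using finQ that by (intro Min_le) (auto simp: Q_def)
      qed
      ultimately show ?thesis unfolding P_def x(1) I_def by (intro exI[of _ r]) (auto intro: order.trans)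
    qed
  qed
  then obtain r where "r > 0" "\<forall>x\<in>S. P x r" by blast
  then show ?thesis unfolding S_def P_def boundary_separation_def by (intro exI[of _ r]) auto
qed

text \<open>For K with end points a and b, the point p is the end at time i of the pulled back collar
  attached to the a-side of \<open>f\<^sup>N(K)\<close>. It has full width \<open>2\<delta>\<close> at time N unless it was truncated at the
  boundary of M. The a-side may lie to the left or to the right, so that b and a can be exchanged.\<close>

definition collar :: "real \<Rightarrow> nat \<Rightarrow> nat \<Rightarrow> real \<Rightarrow> real \<Rightarrow> real \<Rightarrow> bool" where
  "collar \<delta> N i a b p \<longleftrightarrow> p \<in> {0..1} \<and> (f ^^ i) a \<in> closed_segment p ((f ^^ i) b) \<and>
     avoids (N - i) (closed_segment p ((f ^^ i) b)) \<and>
     (\<bar>(f ^^ (N - i)) p - (f ^^ N) a\<bar> = 2 * \<delta> \<or>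
      p \<in> {0, 1} \<and> \<bar>(f ^^ (N - i)) p - (f ^^ N) a\<bar> \<le> 2 * \<delta>)"

text \<open>Two times are involved: \<open>c\<close> obstructs the branch at time \<open>i\<close>,
  whereas \<open>p\<close> is the end of the collar at time \<open>Suc i\<close>, which contains the
  critical value.\<close>

definition crit_hit :: "nat \<Rightarrow> real \<Rightarrow> real \<Rightarrow> real \<Rightarrow> real \<Rightarrow> bool" where
  "crit_hit i a b p c \<longleftrightarrow> c \<in> C \<and> (f ^^ i) a \<in> closed_segment c ((f ^^ i) b) \<and>
     closed_segment c ((f ^^ i) b) \<inter> C = {c} \<and>
     v c (c < (f ^^ i) b) \<in> closed_segment p ((f ^^ Suc i) a)"

lemma collar_start:
  assumes "(f ^^ N) a \<in> {0..1}" "(f ^^ N) b \<in> {0..1}" "0 < \<delta>"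
  shows "\<exists>p. collar \<delta> N N a b p"
proof (cases "(f ^^ N) a \<le> (f ^^ N) b")
  case True
  define p where "p = max 0 ((f ^^ N) a - 2 * \<delta>)"
  have "p \<in> {0..1}" "(f ^^ N) a \<in> closed_segment p ((f ^^ N) b)"
    using assms True unfolding p_def by (auto simp: closed_segment_real_mem)
  then have "collar \<delta> N N a b p"
    using assms closed_segment_subset[of p "{0..1}" "(f ^^ N) b"] unfolding collar_def p_def
    by (auto simp: max_def)
  then show ?thesis by blast
next
  case False
  define p where "p = min 1 ((f ^^ N) a + 2 * \<delta>)"
  have "p \<in> {0..1}" "(f ^^ N) a \<in> closed_segment p ((f ^^ N) b)"
    using assms False unfolding p_def by (auto simp: closed_segment_real_mem)
  then have "collar \<delta> N N a b p"
    using assms closed_segment_subset[of p "{0..1}" "(f ^^ N) b"] unfolding collar_def p_def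
    by (auto simp: min_def)
  then show ?thesis by blast
qed

lemma collar_gap: "collar \<delta> N i a b p \<Longrightarrow> \<bar>(f ^^ (N - i)) p - (f ^^ N) a\<bar> \<le> 2 * \<delta>"
  unfolding collar_def by auto

lemma collar_step:
  assumes K: "homterval (closed_segment a b)" "a \<noteq> b" and "i < N"
    and col: "collar \<delta> N (Suc i) a b p"
  shows "(\<exists>p'. collar \<delta> N i a b p') \<or> (\<exists>c. crit_hit i a b p c)"
proof -
  define a' b' where "a' = (f ^^ i) a" and "b' = (f ^^ i) b"
  have Ni: "N - i = Suc (N - Suc i)" using \<open>i < N\<close> by simp
  define k where "k = N - Suc i"
  have avK: "avoids n (closed_segment a b)" for n using K(1) unfolding homterval_def by blast
  have seg: "closed_segment a' b' = (f ^^ i) ` closed_segment a b"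
    unfolding a'_def b'_def using iterate_image_segment[OF avK] by simp
  have ab': "a' \<in> {0..1}" "b' \<in> {0..1}" "closed_segment a' b' \<inter> C = {}"
    using homterval_point[OF K(1)] unfolding seg unfolding a'_def b'_def by auto
  have ne: "a' \<noteq> b'"
    using iterate_inj[OF avK is_interval_closed_segment_real, of i] K(2) unfolding a'_def b'_def
    by (auto simp: inj_on_def)
  have fa: "f a' = (f ^^ Suc i) a" "f b' = (f ^^ Suc i) b" unfolding a'_def b'_def by auto
  have P: "f a' \<in> closed_segment p (f b')" and avp: "avoids k (closed_segment p (f b'))"
    and gap: "\<bar>(f ^^ k) p - (f ^^ N) a\<bar> \<le> 2 * \<delta>" and p01: "p \<in> {0..1}"
    and stat: "\<bar>(f ^^ k) p - (f ^^ N) a\<bar> = 2 * \<delta> \<or> p \<in> {0, 1}"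
    using col collar_gap[OF col] unfolding collar_def fa k_def by auto
  have Nk: "(f ^^ N) a = (f ^^ k) (f a')"
    unfolding fa k_def funpow_add[symmetric, THEN fun_cong, unfolded o_apply] using \<open>i < N\<close> by simp
  have av: "avoids (Suc k) (closed_segment p' b')"
    if "p' \<in> {0..1}" "closed_segment p' b' \<inter> C = {}" "f p' \<in> closed_segment p (f b')" for p'
  proof -
    have sub: "closed_segment p' b' \<subseteq> {0..1} - C"
      using that(2) closed_segment_subset[OF that(1) ab'(2)] by auto
    have "f ` closed_segment p' b' = closed_segment (f p') (f b')"
      using strictly_monotone_f[OF is_interval_closed_segment_real sub] continuous_on_off_C[OF sub]
      by (rule strictly_monotone_image_segment)
    also have "\<dots> \<subseteq> closed_segment p (f b')" using that(3) by (intro closed_segment_subset) auto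
    finally show ?thesis unfolding avoids_Suc using sub avoids_subset[OF avp] by blast
  qed
  have sub_seg: "closed_segment p (f a') \<subseteq> closed_segment p (f b')"
    using P by (intro closed_segment_subset) auto
  show ?thesis
    using ab'(1,2) ne ab'(3) P
  proof (cases rule: pull_back_endpoint)
    case (exact p')
    have "collar \<delta> N i a b p'"
    proof -
      \<comment> \<open>If the collar at time \<open>Suc i\<close> is truncated, \<open>p\<close> is
        0 or 1, and by \<open>interior_value\<close> its inverse image \<open>p'\<close> is
        too.\<close>
      have "\<bar>(f ^^ k) p - (f ^^ N) a\<bar> = 2 * \<delta> \<or> p' \<in> {0, 1}"
      proof (rule disjCI)
        assume "p' \<notin> {0, 1}"
        moreover have "p' \<notin> C" using exact(3) by auto
        ultimately have "f p' \<in> {0<..<1}" using exact(1) by (intro interior_value) auto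
        then show "\<bar>(f ^^ k) p - (f ^^ N) a\<bar> = 2 * \<delta>" using exact(4) stat by auto
      qed
      moreover have "(f ^^ (N - i)) p' = (f ^^ k) p"
        unfolding Ni k_def[symmetric] funpow_Suc_right using exact(4) by simp
      ultimately show ?thesis
        unfolding collar_def a'_def[symmetric] b'_def[symmetric]
        using exact av[of p'] gap unfolding Ni k_def[symmetric] by auto
    qed
    then show ?thesis by blast
  next
    case (boundary p')
    have "(f ^^ k) (f p') \<in> closed_segment ((f ^^ k) p) ((f ^^ k) (f a'))"
      using iterate_between[OF avoids_subset[OF avp sub_seg] boundary(4)] .
    then have "\<bar>(f ^^ k) (f p') - (f ^^ N) a\<bar> \<le> 2 * \<delta>"
      using gap unfolding Nk by (auto simp: closed_segment_real_mem)
    moreover have "(f ^^ (N - i)) p' = (f ^^ k) (f p')"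
      unfolding Ni k_def[symmetric] funpow_Suc_right by simp
    moreover have "avoids (N - i) (closed_segment p' b')"
      unfolding Ni k_def[symmetric] using boundary sub_seg by (intro av) auto
    ultimately have "collar \<delta> N i a b p'"
      unfolding collar_def a'_def[symmetric] b'_def[symmetric] using boundary by auto
    then show ?thesis by blast
  next
    case (critical c)
    then have "crit_hit i a b p c"
      unfolding crit_hit_def fa[symmetric] a'_def[symmetric] b'_def[symmetric] by blast
    then show ?thesis by blast
  qed
qed

text \<open>The collar on the far side supplies the space for the distortion estimate based at \<open>f(c)\<close>;
  if that collar ends at the boundary of M instead, the separation constant is violated.\<close>

lemma crit_hit_bound:
  assumes K: "homterval (closed_segment a b)" "a \<noteq> b" "x0 \<in> closed_segment a b" and "i < N"
    and p: "collar \<delta> N (Suc i) a b p" and q: "collar \<delta> N (Suc i) b a q"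
    and hit: "crit_hit i a b p c" and \<delta>: "0 < \<delta>"
    and small: "\<bar>(f ^^ N) a - (f ^^ N) b\<bar> \<le> \<delta> / 2"
    and r: "boundary_separation (5 * \<delta>)"
    and s: "s = (c < (f ^^ i) b)"
  shows "crit_deriv c s (N - Suc i) * \<bar>(f ^^ Suc i) b - v c s\<bar> \<le> 6 * \<delta>"
    "\<bar>(f ^^ (N - Suc i)) (v c s) - (f ^^ N) a\<bar> \<le> 2 * \<delta>" "valid_side c s"
    "(f ^^ i) b \<noteq> c"
proof -
  define k where "k = N - Suc i"
  define a1 b1 where "a1 = (f ^^ Suc i) a" and "b1 = (f ^^ Suc i) b"
  define y where "y = v c s"
  have avK: "avoids n (closed_segment a b)" for n using K(1) unfolding homterval_def by blast
  have bC: "(f ^^ i) b \<notin> C" using homterval_point[OF K(1)] by auto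
  have cC: "c \<in> C" using hit unfolding crit_hit_def by blast
  show bc: "(f ^^ i) b \<noteq> c" using bC cC by auto
  have b01: "(f ^^ i) b \<in> {0..1}" using homterval_point[OF K(1)] by auto
  show vs: "valid_side c s"
    using b01 cC C_subset bc s by (intro valid_sideI[of "(f ^^ i) b"]) auto
  have ne: "a1 \<noteq> b1"
    using iterate_inj[OF avK is_interval_closed_segment_real, of "Suc i"] K(2) unfolding a1_def b1_def
    by (auto simp: inj_on_def)
  have Nk: "(f ^^ k) ((f ^^ Suc i) t) = (f ^^ N) t" for t
    unfolding k_def funpow_add[symmetric, THEN fun_cong, unfolded o_apply] using \<open>i < N\<close> by simp
  have ap: "a1 \<in> closed_segment p b1" and avp: "avoids k (closed_segment p b1)"
    and bq: "b1 \<in> closed_segment q a1" and avq: "avoids k (closed_segment q a1)"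
    and gapp: "\<bar>(f ^^ k) p - (f ^^ N) a\<bar> \<le> 2 * \<delta>"
    and gapq: "\<bar>(f ^^ k) q - (f ^^ N) b\<bar> \<le> 2 * \<delta>"
    and stat: "\<bar>(f ^^ k) q - (f ^^ N) b\<bar> = 2 * \<delta> \<or> q \<in> {0, 1}"
    using p q collar_gap[OF p] collar_gap[OF q] unfolding collar_def a1_def b1_def k_def by auto
  have yp: "y \<in> closed_segment p a1" using hit unfolding crit_hit_def y_def a1_def s by blast
  have "closed_segment p a1 \<subseteq> closed_segment p b1" using ap by (intro closed_segment_subset) auto
  then have "(f ^^ k) y \<in> closed_segment ((f ^^ k) p) ((f ^^ k) a1)"
    using iterate_between[OF avoids_subset[OF avp] yp] by blast
  then show gapy: "\<bar>(f ^^ (N - Suc i)) (v c s) - (f ^^ N) a\<bar> \<le> 2 * \<delta>"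
    using gapp Nk[of a] unfolding k_def[symmetric] y_def[symmetric] a1_def[symmetric]
    by (auto simp: closed_segment_real_mem)
  \<comment> \<open>The two collars overlap in the segment from \<open>a1\<close> to
    \<open>b1\<close>, so together they contain the whole segment from the critical value to
    \<open>q\<close>.\<close>
  have "closed_segment y q \<subseteq> closed_segment p b1 \<union> closed_segment q a1"
    using yp ap bq ne by (auto simp: closed_segment_real_mem)
  then have avy: "avoids k (closed_segment y q)"
    using avoids_subset avoids_Un[OF avp avq] by blast
  have aby: "a1 \<in> closed_segment y q" and by1: "b1 \<in> closed_segment y q"
    using yp ap bq ne by (auto simp: closed_segment_real_mem)
  have "closed_segment a1 b1 \<subseteq> closed_segment y q" using aby by1 by (intro closed_segment_subset) auto
  moreover have "(f ^^ Suc i) x0 \<in> closed_segment a1 b1"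
    unfolding a1_def b1_def using iterate_between[OF avK K(3)] .
  ultimately have xin: "(f ^^ Suc i) x0 \<in> closed_segment q y"
    by (metis closed_segment_commute subset_iff)
  \<comment> \<open>Otherwise \<open>q\<close> lies in \<open>{0, 1}\<close> and separation applies,
    but the images of \<open>q\<close> and \<open>y\<close> are at most
    \<open>2 * \<delta> + \<delta> / 2 + 2 * \<delta> < 5 * \<delta>\<close> apart.\<close>
  have full: "\<bar>(f ^^ k) q - (f ^^ N) b\<bar> = 2 * \<delta>"
  proof (rule ccontr)
    assume "\<not> ?thesis"
    then have "q \<in> {0, 1}" using stat by blast
    moreover have "q \<noteq> y" using aby by1 ne by auto
    ultimately have "5 * \<delta> \<le> \<bar>(f ^^ k) q - (f ^^ k) y\<bar>"
      using r cC vs xin avy closed_segment_commute[of y q] unfolding boundary_separation_def y_def by metis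
    then show False using gapq gapy small \<delta> unfolding k_def[symmetric] y_def[symmetric] by linarith
  qed
  define S where "S = \<bar>(f ^^ k) b1 - (f ^^ k) y\<bar>"
  have "\<bar>iter_deriv f Df k y\<bar> * \<bar>b1 - y\<bar> * \<bar>(f ^^ k) q - (f ^^ k) b1\<bar>
     \<le> S * (S + \<bar>(f ^^ k) q - (f ^^ k) b1\<bar>)"
    unfolding S_def by (rule distortion[OF avy by1])
  then have main: "crit_deriv c s k * \<bar>b1 - y\<bar> * (2 * \<delta>) \<le> S * (S + 2 * \<delta>)"
    using full Nk[of b] unfolding b1_def[symmetric] crit_deriv_def y_def by simp
  have "S \<le> 5 / 2 * \<delta>"
    using gapy small Nk[of b] unfolding S_def b1_def[symmetric] k_def[symmetric] y_def[symmetric] by linarith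
  moreover have "0 \<le> S" unfolding S_def by simp
  \<comment> \<open>Origin of the constant 6: \<open>5/2 * 9/2 = 45/4\<close> is at most
    \<open>12 = 6 * 2\<close>.\<close>
  ultimately have "S * (S + 2 * \<delta>) \<le> (5 / 2 * \<delta>) * (5 / 2 * \<delta> + 2 * \<delta>)"
    using \<delta> by (intro mult_mono) auto
  also have "\<dots> \<le> 6 * \<delta> * (2 * \<delta>)" using \<delta> by simp
  finally have "crit_deriv c s k * \<bar>b1 - y\<bar> * (2 * \<delta>) \<le> 6 * \<delta> * (2 * \<delta>)" using main by linarith
  then show "crit_deriv c s (N - Suc i) * \<bar>(f ^^ Suc i) b - v c s\<bar> \<le> 6 * \<delta>"
    using \<delta> unfolding k_def b1_def y_def by simp
qed

definition order_constant :: "real \<Rightarrow> bool" where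
  "order_constant A \<longleftrightarrow> (\<forall>c\<in>C. \<forall>s. valid_side c s \<longrightarrow> (\<forall>x\<in>{0..1}. x \<noteq> c \<longrightarrow> s = (c < x) \<longrightarrow>
     closed_segment c x \<inter> C = {c} \<longrightarrow> A * \<bar>x - c\<bar> powr l c s \<le> \<bar>f x - v c s\<bar>))"

lemma order_constant_exists: "\<exists>A>0. order_constant A"
proof -
  define S where "S = {(c, s). c \<in> C \<and> valid_side c s}"
  have finS: "finite S" unfolding S_def by (rule finite_sides)
  define P where "P = (\<lambda>(c, s) A. \<forall>x\<in>{0..1}. x \<noteq> c \<longrightarrow> s = (c < x) \<longrightarrow>
     closed_segment c x \<inter> C = {c} \<longrightarrow> A * \<bar>x - c\<bar> powr l c s \<le> \<bar>f x - v c s\<bar>)"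
  have "\<exists>A>0. \<forall>A'. 0 < A' \<and> A' \<le> A \<longrightarrow> (\<forall>cs\<in>S. P cs A')"
  proof (rule finite_uniform_bound[OF finS])
    fix cs assume "cs \<in> S"
    then obtain c s where cs: "cs = (c, s)" "c \<in> C" "valid_side c s" unfolding S_def by blast
    obtain A where A: "A > 0" "\<And>x. x \<in> {0..1} \<Longrightarrow> x \<noteq> c \<Longrightarrow> s = (c < x) \<Longrightarrow>
       closed_segment c x \<inter> C = {c} \<Longrightarrow> A * \<bar>x - c\<bar> powr l c s \<le> \<bar>f x - v c s\<bar>"
      using order_lower_bound[OF cs(2,3)] by blast
    have "A' * \<bar>x - c\<bar> powr l c s \<le> \<bar>f x - v c s\<bar>"
      if "A' \<le> A" "x \<in> {0..1}" "x \<noteq> c" "s = (c < x)" "closed_segment c x \<inter> C = {c}" for A' x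
    proof -
      have "A' * \<bar>x - c\<bar> powr l c s \<le> A * \<bar>x - c\<bar> powr l c s"
        using that(1) by (intro mult_right_mono) auto
      then show ?thesis using A(2)[OF that(2-5)] by linarith
    qed
    then show "\<exists>A>0. \<forall>A'. 0 < A' \<and> A' \<le> A \<longrightarrow> P cs A'"
      unfolding P_def cs(1) using A(1) by blast
  qed
  then obtain A where "A > 0" "\<forall>cs\<in>S. P cs A" by blast
  then show ?thesis unfolding S_def P_def order_constant_def by (intro exI[of _ A]) auto
qed

text \<open>Both collars are pulled back in parallel up to the first obstruction, because
  \<open>crit_hit_bound\<close> takes its space from the opposite collar at time
  \<open>Suc i\<close>. \<open>\<theta>\<close> is the distance from \<open>c\<close> to the far end
  of K at time \<open>i\<close>, so both ends are within it; the order at \<open>c\<close> turns the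
  bound near the critical value into one on \<open>\<theta> powr l c s\<close>.\<close>

lemma pull_back:
  assumes K: "homterval (closed_segment a b)" "a \<noteq> b" "x0 \<in> closed_segment a b"
    and \<delta>: "0 < \<delta>" and small: "\<bar>(f ^^ N) a - (f ^^ N) b\<bar> \<le> \<delta> / 2"
    and r: "boundary_separation (5 * \<delta>)"
    and A: "order_constant A"
  shows "(\<exists>p q. collar \<delta> N 0 a b p \<and> collar \<delta> N 0 b a q) \<or>
    (\<exists>i<N. \<exists>c\<in>C. \<exists>s \<theta>. valid_side c s \<and> 0 < \<theta> \<and> \<bar>(f ^^ i) a - c\<bar> \<le> \<theta> \<and> \<bar>(f ^^ i) b - c\<bar> \<le> \<theta> \<and>
       crit_deriv c s (N - Suc i) * (A * \<theta> powr l c s) \<le> 6 * \<delta> \<and>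
       (\<bar>(f ^^ (N - Suc i)) (v c s) - (f ^^ N) a\<bar> \<le> 2 * \<delta> \<or>
        \<bar>(f ^^ (N - Suc i)) (v c s) - (f ^^ N) b\<bar> \<le> 2 * \<delta>))"
    (is "_ \<or> ?Hit")
proof -
  have hit: ?Hit if ab: "(a', b') = (a, b) \<or> (a', b') = (b, a)" and i: "i < N"
    and p: "collar \<delta> N (Suc i) a' b' p" and q: "collar \<delta> N (Suc i) b' a' q"
    and h: "crit_hit i a' b' p c" for a' b' i p q c
  proof -
    define s where "s = (c < (f ^^ i) b')"
    define \<theta> where "\<theta> = \<bar>(f ^^ i) b' - c\<bar>"
    have K': "homterval (closed_segment a' b')" "a' \<noteq> b'" "x0 \<in> closed_segment a' b'"
      "\<bar>(f ^^ N) a' - (f ^^ N) b'\<bar> \<le> \<delta> / 2"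
      using ab K small by (auto simp: closed_segment_commute abs_minus_commute)
    note B = crit_hit_bound[OF K'(1-3) i p q h \<delta> K'(4) r s_def]
    have c: "c \<in> C" "(f ^^ i) a' \<in> closed_segment c ((f ^^ i) b')" "closed_segment c ((f ^^ i) b') \<inter> C = {c}"
      using h unfolding crit_hit_def by auto
    have b01: "(f ^^ i) b' \<in> {0..1}" using homterval_point[OF K'(1)] by auto
    have "A * \<theta> powr l c s \<le> \<bar>(f ^^ Suc i) b' - v c s\<bar>"
      unfolding \<theta>_def using A c(1) B(3) b01 B(4) s_def c(3) unfolding order_constant_def by simp
    then have "crit_deriv c s (N - Suc i) * (A * \<theta> powr l c s)
        \<le> crit_deriv c s (N - Suc i) * \<bar>(f ^^ Suc i) b' - v c s\<bar>"
      using crit_deriv_pos[OF c(1) B(3)] by (intro mult_left_mono) (auto simp: less_imp_le)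
    then have 1: "crit_deriv c s (N - Suc i) * (A * \<theta> powr l c s) \<le> 6 * \<delta>" using B(1) by linarith
    have "0 < \<theta>" "\<bar>(f ^^ i) a' - c\<bar> \<le> \<theta>" "\<bar>(f ^^ i) b' - c\<bar> \<le> \<theta>"
      unfolding \<theta>_def using B(4) c(2) by (auto simp: closed_segment_real_mem)
    then show ?thesis using i c(1) B(2,3) 1 ab by blast
  qed
  have "j \<le> N \<Longrightarrow> (\<exists>p q. collar \<delta> N (N - j) a b p \<and> collar \<delta> N (N - j) b a q) \<or> ?Hit" for j
  proof (induction j)
    case 0
    have "(f ^^ N) a \<in> {0..1}" "(f ^^ N) b \<in> {0..1}"
      using homterval_point[OF K(1)] by auto
    then show ?case using collar_start \<delta> by auto
  next
    case (Suc j)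
    define i where "i = N - Suc j"
    have i: "i < N" "N - j = Suc i" using Suc.prems unfolding i_def by auto
    from Suc have "(\<exists>p q. collar \<delta> N (Suc i) a b p \<and> collar \<delta> N (Suc i) b a q) \<or> ?Hit"
      unfolding i(2)[symmetric] by simp
    then show ?case
    proof
      assume "\<exists>p q. collar \<delta> N (Suc i) a b p \<and> collar \<delta> N (Suc i) b a q"
      then obtain p q where pq: "collar \<delta> N (Suc i) a b p" "collar \<delta> N (Suc i) b a q" by blast
      have K2: "homterval (closed_segment b a)" using K(1) by (simp add: closed_segment_commute)
      show ?thesis
        using collar_step[OF K(1,2) i(1) pq(1)] collar_step[OF K2 K(2)[symmetric] i(1) pq(2)]
          hit[OF _ i(1) pq] hit[OF _ i(1) pq(2,1)] unfolding i_def[symmetric] by blast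
    qed blast
  qed
  from this[of N] show ?thesis by simp
qed

text \<open>By the mean value theorem some \<open>u\<close> in the collar at \<open>a\<close> has
  derivative modulus \<open>D\<close> with \<open>D * |p - a| = 2 * \<delta>\<close>. The distortion
  estimate based at \<open>u\<close>, with the collar at \<open>b\<close> as space, gives
  \<open>D * |b - u| \<le> 6 * \<delta>\<close>, and \<open>|a - b| \<le> |b - u|\<close>.\<close>

lemma collar_width:
  assumes av: "avoids N (closed_segment p q)" and ab: "a \<in> closed_segment p b" "b \<in> closed_segment a q" "a \<noteq> b"
    and \<delta>: "0 < \<delta>" and p: "\<bar>(f ^^ N) p - (f ^^ N) a\<bar> = 2 * \<delta>" and q: "\<bar>(f ^^ N) q - (f ^^ N) b\<bar> = 2 * \<delta>"
    and small: "\<bar>(f ^^ N) a - (f ^^ N) b\<bar> \<le> \<delta> / 2"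
  shows "\<bar>a - b\<bar> \<le> 3 * \<bar>p - a\<bar>"
proof -
  define g where "g = f ^^ N"
  have sub: "closed_segment p a \<subseteq> closed_segment p q"
    using ab by (auto simp: closed_segment_real_mem)
  have "\<exists>u\<in>closed_segment p a. \<bar>g p - g a\<bar> = \<bar>iter_deriv f Df N u\<bar> * \<bar>p - a\<bar>"
  proof -
    define lo hi where "lo = min p a" and "hi = max p a"
    have seg: "{lo..hi} = closed_segment p a" unfolding lo_def hi_def by (auto simp: closed_segment_eq_real_ivl)
    have "(g has_derivative (\<lambda>t. iter_deriv f Df N x * t)) (at x within {lo..hi})" if "lo \<le> x" "x \<le> hi" for x
    proof -
      have "x \<in> closed_segment p a" using that unfolding seg[symmetric] by simp
      then show ?thesis
        using iterate_has_deriv[OF avoids_subset[OF av sub]] unfolding has_field_derivative_def seg g_def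
        by (metis (no_types, lifting))
    qed
    then have "\<exists>x\<in>{lo..hi}. g hi - g lo = iter_deriv f Df N x * (hi - lo)"
      by (intro mvt_very_simple) (auto simp: lo_def hi_def)
    then obtain u where u: "u \<in> closed_segment p a" "g hi - g lo = iter_deriv f Df N u * (hi - lo)"
      unfolding seg by blast
    then have "\<bar>g hi - g lo\<bar> = \<bar>iter_deriv f Df N u\<bar> * \<bar>hi - lo\<bar>" by (simp add: abs_mult)
    then show ?thesis using u(1) unfolding lo_def hi_def min_def max_def
      by (auto split: if_splits simp: abs_minus_commute)
  qed
  then obtain u where u: "u \<in> closed_segment p a" "\<bar>g p - g a\<bar> = \<bar>iter_deriv f Df N u\<bar> * \<bar>p - a\<bar>" by blast
  define D where "D = \<bar>iter_deriv f Df N u\<bar>"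
  have subu: "closed_segment u q \<subseteq> closed_segment p q"
    using u(1) sub by (intro closed_segment_subset) auto
  have avu: "avoids N (closed_segment u q)" using avoids_subset[OF av subu] .
  have bu: "b \<in> closed_segment u q" using u(1) ab by (auto simp: closed_segment_real_mem)
  define S where "S = \<bar>g b - g u\<bar>"
  have "D * \<bar>b - u\<bar> * \<bar>g q - g b\<bar> \<le> S * (S + \<bar>g q - g b\<bar>)"
    unfolding D_def g_def S_def by (rule distortion[OF avu bu])
  then have 1: "D * \<bar>b - u\<bar> * (2 * \<delta>) \<le> S * (S + 2 * \<delta>)" using q unfolding g_def by simp
  have "g u \<in> closed_segment (g p) (g a)"
    unfolding g_def using iterate_between[OF avoids_subset[OF av sub] u(1)] .
  then have "\<bar>g u - g a\<bar> \<le> 2 * \<delta>" using p unfolding g_def by (auto simp: closed_segment_real_mem)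
  then have "S \<le> 5 / 2 * \<delta>" using small unfolding S_def g_def by linarith
  moreover have "0 \<le> S" unfolding S_def by simp
  ultimately have "S * (S + 2 * \<delta>) \<le> (5 / 2 * \<delta>) * (5 / 2 * \<delta> + 2 * \<delta>)"
    using \<delta> by (intro mult_mono) auto
  also have "\<dots> \<le> 6 * \<delta> * (2 * \<delta>)" using \<delta> by simp
  finally have "D * \<bar>b - u\<bar> * (2 * \<delta>) \<le> 6 * \<delta> * (2 * \<delta>)" using 1 by linarith
  then have "D * \<bar>b - u\<bar> \<le> 6 * \<delta>" using \<delta> by simp
  moreover have "D * \<bar>a - b\<bar> \<le> D * \<bar>b - u\<bar>"
    using u(1) ab unfolding D_def by (intro mult_left_mono) (auto simp: closed_segment_real_mem)
  moreover have Dpa: "D * \<bar>p - a\<bar> = 2 * \<delta>" using u(2) p unfolding D_def g_def by simp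
  ultimately have "D * \<bar>a - b\<bar> \<le> D * (3 * \<bar>p - a\<bar>)" by simp
  moreover have "0 < D" using Dpa \<delta> unfolding D_def by (cases "iter_deriv f Df N u = 0") auto
  ultimately show ?thesis by simp
qed

section \<open>Thickening\<close>

text \<open>Otherwise the segment from \<open>e\<close> to \<open>x0\<close> would be a homterval,
  against \<open>no_boundary\<close>. So collars that reach time 0 from a late time are not
  truncated.\<close>

lemma boundary_not_reached:
  "\<exists>n. \<forall>N\<ge>n. \<forall>e\<in>{0, 1}. \<not> avoids N (closed_segment e x0)"
proof -
  have "\<exists>n. \<not> avoids n (closed_segment e x0)" if "e \<in> {0, 1}" for e
    using no_boundary[of "closed_segment e x0" 0] that is_interval_closed_segment_real
    unfolding homterval_def by (metis ends_in_segment empty_iff funpow_0 insert_iff)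
  then obtain n0 n1 where "\<not> avoids n0 (closed_segment 0 x0)" "\<not> avoids n1 (closed_segment 1 x0)"
    by blast
  then show ?thesis using avoids_mono by (intro exI[of _ "max n0 n1"]) auto
qed

text \<open>Fix the number \<open>n0\<close> of iterates to be controlled. It suffices to bring two
  full collars back to time 0 from some \<open>N \<ge> n0\<close>, since by
  \<open>collar_width\<close> each then has length at least \<open>(b - a) / 3\<close>.\<close>

lemma homterval_thicken:
  assumes K: "homterval {a..b}" "a < b" "x0 \<in> {a..b}"
  shows "homterval {a - (b - a) / 3..b + (b - a) / 3}"
  unfolding homterval_def
proof
  fix n0
  have segK: "{a..b} = closed_segment a b" using K(2) by (simp add: closed_segment_eq_real_ivl)
  have Ks: "homterval (closed_segment a b)" "a \<noteq> b" "x0 \<in> closed_segment a b"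
    using K unfolding segK by auto
  obtain nb where nb: "\<And>N e. N \<ge> nb \<Longrightarrow> e \<in> {0, 1} \<Longrightarrow> \<not> avoids N (closed_segment e x0)"
    using boundary_not_reached by blast
  define N0 where "N0 = max n0 nb"
  define C2 where "C2 = {(c, s). c \<in> C \<and> valid_side c s}"
  have finC2: "finite C2" unfolding C2_def by (rule finite_sides)
  obtain A where A: "A > 0" "order_constant A" using order_constant_exists by blast
  obtain E0 where E0: "E0 > 0" "\<And>c s n. c \<in> C \<Longrightarrow> valid_side c s \<Longrightarrow> E0 \<le> crit_deriv c s n"
    using crit_deriv_lower by blast
  \<comment> \<open>The constant \<open>2 * 6 powr l c s / A\<close> is chosen so that a hit at
    scale \<open>\<delta>\<close> yields
    \<open>(6 * \<theta>) powr l c s \<le> (3 * \<delta>) powr l c s\<close>, that is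
    \<open>\<theta> \<le> \<delta> / 2\<close>.\<close>
  obtain r1 where r1: "r1 > 0" "\<And>\<delta> c s n c0. 0 < \<delta> \<Longrightarrow> \<delta> \<le> r1 \<Longrightarrow> c \<in> C \<Longrightarrow> valid_side c s \<Longrightarrow> c0 \<in> C \<Longrightarrow>
      \<bar>(f ^^ n) (v c s) - c0\<bar> \<le> \<delta> \<Longrightarrow> 2 * 6 powr l c s / A \<le> crit_deriv c s n * \<delta> powr (l c s - 1)"
    using crit_deriv_close[of "\<lambda>c s. 2 * 6 powr l c s / A"] by metis
  obtain r where r: "r > 0" "boundary_separation r" using boundary_separation_exists by blast
  have "\<exists>d>0. \<forall>d'. 0 < d' \<and> d' \<le> d \<longrightarrow>
      (\<forall>jc\<in>{..<N0} \<times> C. (\<lambda>jc e. e < \<bar>(f ^^ fst jc) a - snd jc\<bar>) jc d')"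
  proof (rule finite_uniform_bound)
    show "finite ({..<N0} \<times> C)" using finite_C by simp
    fix jc assume "jc \<in> {..<N0} \<times> C"
    then have "0 < \<bar>(f ^^ fst jc) a - snd jc\<bar>"
      using homterval_point(2)[OF K(1), of a "fst jc"] K(2) by auto
    then show "\<exists>e>0. \<forall>e'. 0 < e' \<and> e' \<le> e \<longrightarrow> e' < \<bar>(f ^^ fst jc) a - snd jc\<bar>"
      by (intro exI[of _ "\<bar>(f ^^ fst jc) a - snd jc\<bar> / 2"]) auto
  qed
  then obtain d0 where d0: "d0 > 0" and "\<forall>jc\<in>{..<N0} \<times> C. d0 < \<bar>(f ^^ fst jc) a - snd jc\<bar>"
    by blast
  then have d0': "d0 < \<bar>(f ^^ j) a - c\<bar>" if "j < N0" "c \<in> C" for j c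
    using that by (metis SigmaI fst_conv lessThan_iff snd_conv)
  \<comment> \<open>\<open>3 * \<delta> \<le> r1\<close> since the critical orbit comes within
    \<open>2 * \<delta> + \<delta> / 2\<close> of \<open>C\<close>;
    \<open>5 * \<delta> \<le> r\<close> for the boundary separation;
    \<open>\<delta> \<le> d0\<close> so that \<open>near\<close> fails at all times before
    \<open>N0\<close>.\<close>
  define \<delta> where "\<delta> = min (r1 / 3) (min (r / 5) d0)"
  have \<delta>: "0 < \<delta>" "3 * \<delta> \<le> r1" "5 * \<delta> \<le> r" "\<delta> \<le> d0"
    using r1(1) r(1) d0 unfolding \<delta>_def by auto
  have sep: "boundary_separation (5 * \<delta>)" using boundary_separation_mono[OF r(2) \<delta>(3)] .
  \<comment> \<open>Scale of the first pull-back: with only \<open>E0\<close> as lower bound for the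
    derivative, \<open>6 * e \<le> E0 * (A * (\<delta> / 2) powr l c s)\<close> already forces
    \<open>\<theta> \<le> \<delta> / 2\<close>.\<close>
  have "\<exists>e>0. \<forall>e'. 0 < e' \<and> e' \<le> e \<longrightarrow>
      (\<forall>cs\<in>C2. (\<lambda>cs e. 6 * e \<le> E0 * (A * (\<delta> / 2) powr l (fst cs) (snd cs))) cs e')"
  proof (rule finite_uniform_bound[OF finC2])
    fix cs
    have "0 < E0 * (A * (\<delta> / 2) powr l (fst cs) (snd cs))" using E0 A \<delta> by simp
    then show "\<exists>e>0. \<forall>e'. 0 < e' \<and> e' \<le> e \<longrightarrow> 6 * e' \<le> E0 * (A * (\<delta> / 2) powr l (fst cs) (snd cs))"
      by (intro exI[of _ "E0 * (A * (\<delta> / 2) powr l (fst cs) (snd cs)) / 6"]) auto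
  qed
  then obtain e0 where e0: "e0 > 0" "\<And>e c s. 0 < e \<Longrightarrow> e \<le> e0 \<Longrightarrow> c \<in> C \<Longrightarrow> valid_side c s \<Longrightarrow>
      6 * e \<le> E0 * (A * (\<delta> / 2) powr l c s)"
    unfolding C2_def by force
  define \<delta>0 where "\<delta>0 = min e0 \<delta>"
  have \<delta>0: "0 < \<delta>0" "\<delta>0 \<le> e0" "\<delta>0 \<le> \<delta>" using e0(1) \<delta>(1) unfolding \<delta>0_def by auto

  define near where "near N \<longleftrightarrow> (\<exists>c\<in>C. \<bar>(f ^^ N) a - c\<bar> \<le> \<delta> / 2 \<and> \<bar>(f ^^ N) b - c\<bar> \<le> \<delta> / 2)" for N
  define goal where "goal \<longleftrightarrow> (\<exists>N\<ge>N0. \<exists>\<epsilon>>0. \<exists>p q. collar \<epsilon> N 0 a b p \<and> collar \<epsilon> N 0 b a q \<and>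
      \<bar>(f ^^ N) a - (f ^^ N) b\<bar> \<le> \<epsilon> / 2)"

  have near_goal: "near N \<Longrightarrow> goal" for N
  proof (induction N rule: less_induct)
    case (less N)
    then obtain c0 where c0: "c0 \<in> C" "\<bar>(f ^^ N) a - c0\<bar> \<le> \<delta> / 2" "\<bar>(f ^^ N) b - c0\<bar> \<le> \<delta> / 2"
      unfolding near_def by blast
    have N: "N \<ge> N0"
    proof (rule ccontr)
      assume "\<not> N \<ge> N0"
      then have "d0 < \<bar>(f ^^ N) a - c0\<bar>" using d0' c0(1) by simp
      then show False using c0(2) \<delta>(1,4) by linarith
    qed
    \<comment> \<open>Both ends lie on the same side of \<open>c0\<close>, so they are at most
      \<open>\<delta> / 2\<close> apart rather than \<open>\<delta>\<close>, as
      \<open>pull_back\<close> at scale \<open>\<delta>\<close> requires.\<close>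
    have "c0 \<notin> closed_segment ((f ^^ N) a) ((f ^^ N) b)"
      using homterval_image[OF Ks(1), of N] iterate_image_segment[of N a b] Ks(1) c0(1)
      unfolding homterval_def by (metis Ks(1) disjoint_iff homterval_iff)
    then have small: "\<bar>(f ^^ N) a - (f ^^ N) b\<bar> \<le> \<delta> / 2"
      using c0(2,3) unfolding closed_segment_real_mem by linarith
    from pull_back[OF Ks \<delta>(1) small sep A(2)] show ?case
    proof
      assume "\<exists>p q. collar \<delta> N 0 a b p \<and> collar \<delta> N 0 b a q"
      then show goal unfolding goal_def using N \<delta>(1) small by blast
    next
      assume "\<exists>i<N. \<exists>c\<in>C. \<exists>s \<theta>. valid_side c s \<and> 0 < \<theta> \<and> \<bar>(f ^^ i) a - c\<bar> \<le> \<theta> \<and> \<bar>(f ^^ i) b - c\<bar> \<le> \<theta> \<and>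
       crit_deriv c s (N - Suc i) * (A * \<theta> powr l c s) \<le> 6 * \<delta> \<and>
       (\<bar>(f ^^ (N - Suc i)) (v c s) - (f ^^ N) a\<bar> \<le> 2 * \<delta> \<or>
        \<bar>(f ^^ (N - Suc i)) (v c s) - (f ^^ N) b\<bar> \<le> 2 * \<delta>)"
      then obtain i c s \<theta> where i: "i < N" and cs: "c \<in> C" "valid_side c s"
        and \<theta>: "0 < \<theta>" "\<bar>(f ^^ i) a - c\<bar> \<le> \<theta>" "\<bar>(f ^^ i) b - c\<bar> \<le> \<theta>"
          "crit_deriv c s (N - Suc i) * (A * \<theta> powr l c s) \<le> 6 * \<delta>"
        and cl: "\<bar>(f ^^ (N - Suc i)) (v c s) - (f ^^ N) a\<bar> \<le> 2 * \<delta> \<or>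
          \<bar>(f ^^ (N - Suc i)) (v c s) - (f ^^ N) b\<bar> \<le> 2 * \<delta>"
        by blast
      define D where "D = crit_deriv c s (N - Suc i)"
      have D: "0 < D" unfolding D_def by (rule crit_deriv_pos[OF cs])
      have l1: "1 \<le> l c s" using order_ge_1[OF cs] .
      have "\<bar>(f ^^ (N - Suc i)) (v c s) - c0\<bar> \<le> 3 * \<delta>" using cl c0(2,3) \<delta>(1) by linarith
      then have "2 * 6 powr l c s / A \<le> D * (3 * \<delta>) powr (l c s - 1)"
        unfolding D_def using \<delta> cs c0(1) by (intro r1(2)) auto
      then have big: "2 * 6 powr l c s \<le> D * (3 * \<delta>) powr (l c s - 1) * A"
        using A(1) by (simp add: field_simps)
      have pw: "3 * \<delta> * (3 * \<delta>) powr (l c s - 1) = (3 * \<delta>) powr l c s"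
        using \<delta>(1) by (simp add: powr_diff)
      have "2 * (6 * \<theta>) powr l c s = 2 * 6 powr l c s * \<theta> powr l c s"
        using \<theta>(1) by (simp add: powr_mult)
      also have "\<dots> \<le> D * (3 * \<delta>) powr (l c s - 1) * A * \<theta> powr l c s"
        using big by (intro mult_right_mono) auto
      also have "\<dots> = (3 * \<delta>) powr (l c s - 1) * (D * (A * \<theta> powr l c s))" by simp
      also have "\<dots> \<le> (3 * \<delta>) powr (l c s - 1) * (6 * \<delta>)"
        using \<theta>(4) unfolding D_def by (intro mult_left_mono) auto
      also have "\<dots> = 2 * (3 * \<delta>) powr l c s" unfolding pw[symmetric] by simp
      finally have "(6 * \<theta>) powr l c s \<le> (3 * \<delta>) powr l c s" by simp
      then have "\<theta> \<le> \<delta> / 2"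
        using powr_less_mono2[of "l c s" "3 * \<delta>" "6 * \<theta>"] l1 \<delta>(1) by (cases "3 * \<delta> < 6 * \<theta>") auto
      then have "near i" unfolding near_def using cs(1) \<theta>(2,3) by (intro bexI[of _ c]) auto
      then show goal using less.IH[OF i] by blast
    qed
  qed

  have goal
  proof -
    have "eventually (\<lambda>N. \<bar>(f ^^ N) a - (f ^^ N) b\<bar> < \<delta>0 / 2) sequentially"
      using order_tendstoD(2)[OF homterval_lengths[OF K(1,3)], of "\<delta>0 / 2"] \<delta>0(1) by simp
    then obtain N1 where N1: "\<And>N. N \<ge> N1 \<Longrightarrow> \<bar>(f ^^ N) a - (f ^^ N) b\<bar> < \<delta>0 / 2"
      unfolding eventually_sequentially by blast
    define N where "N = max N0 N1"
    have small: "\<bar>(f ^^ N) a - (f ^^ N) b\<bar> \<le> \<delta>0 / 2" using N1[of N] unfolding N_def by simp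
    have sep0: "boundary_separation (5 * \<delta>0)"
      using boundary_separation_mono[OF sep] \<delta>0 by simp
    from pull_back[OF Ks \<delta>0(1) small sep0 A(2)] show goal
    proof
      assume "\<exists>p q. collar \<delta>0 N 0 a b p \<and> collar \<delta>0 N 0 b a q"
      moreover have "N \<ge> N0" unfolding N_def by simp
      ultimately show goal unfolding goal_def using \<delta>0(1) small by blast
    next
      assume "\<exists>i<N. \<exists>c\<in>C. \<exists>s \<theta>. valid_side c s \<and> 0 < \<theta> \<and> \<bar>(f ^^ i) a - c\<bar> \<le> \<theta> \<and> \<bar>(f ^^ i) b - c\<bar> \<le> \<theta> \<and>
       crit_deriv c s (N - Suc i) * (A * \<theta> powr l c s) \<le> 6 * \<delta>0 \<and>
       (\<bar>(f ^^ (N - Suc i)) (v c s) - (f ^^ N) a\<bar> \<le> 2 * \<delta>0 \<or>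
        \<bar>(f ^^ (N - Suc i)) (v c s) - (f ^^ N) b\<bar> \<le> 2 * \<delta>0)"
      then obtain i c s \<theta> where cs: "c \<in> C" "valid_side c s"
        and \<theta>: "0 < \<theta>" "\<bar>(f ^^ i) a - c\<bar> \<le> \<theta>" "\<bar>(f ^^ i) b - c\<bar> \<le> \<theta>"
          "crit_deriv c s (N - Suc i) * (A * \<theta> powr l c s) \<le> 6 * \<delta>0"
        by blast
      have l1: "1 \<le> l c s" using order_ge_1[OF cs] .
      have "E0 * (A * \<theta> powr l c s) \<le> crit_deriv c s (N - Suc i) * (A * \<theta> powr l c s)"
        using E0(2)[OF cs] A(1) by (intro mult_right_mono) auto
      also have "\<dots> \<le> E0 * (A * (\<delta> / 2) powr l c s)"
        using \<theta>(4) e0(2)[OF \<delta>0(1,2) cs] by linarith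
      finally have "\<theta> powr l c s \<le> (\<delta> / 2) powr l c s" using E0(1) A(1) by simp
      then have "\<theta> \<le> \<delta> / 2"
        using powr_less_mono2[of "l c s" "\<delta> / 2" \<theta>] l1 \<delta>(1) by (cases "\<delta> / 2 < \<theta>") auto
      then have "near i" unfolding near_def using cs(1) \<theta>(2,3) by (intro bexI[of _ c]) auto
      then show goal by (rule near_goal)
    qed
  qed
  then obtain N \<epsilon> p q where N: "N \<ge> N0" and \<epsilon>: "\<epsilon> > 0" and cp: "collar \<epsilon> N 0 a b p" and cq: "collar \<epsilon> N 0 b a q"
    and small: "\<bar>(f ^^ N) a - (f ^^ N) b\<bar> \<le> \<epsilon> / 2"
    unfolding goal_def by blast
  have p: "p \<in> {0..1}" "a \<in> closed_segment p b" "avoids N (closed_segment p b)"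
    and q: "q \<in> {0..1}" "b \<in> closed_segment q a" "avoids N (closed_segment q a)"
    using cp cq unfolding collar_def by auto
  have pa: "p \<le> a" and bq: "b \<le> q" using p(2) q(2) K(2) by (auto simp: closed_segment_real_mem)
  have "closed_segment p x0 \<subseteq> closed_segment p b" "closed_segment q x0 \<subseteq> closed_segment q a"
    using K pa bq by (auto simp: closed_segment_real_mem)
  then have "avoids N (closed_segment p x0)" "avoids N (closed_segment q x0)"
    using avoids_subset p(3) q(3) by blast+
  then have "p \<notin> {0, 1}" "q \<notin> {0, 1}" using nb[of N] N unfolding N0_def by auto
  then have gp: "\<bar>(f ^^ N) p - (f ^^ N) a\<bar> = 2 * \<epsilon>" and gq: "\<bar>(f ^^ N) q - (f ^^ N) b\<bar> = 2 * \<epsilon>"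
    using cp cq unfolding collar_def by auto
  have "closed_segment p q \<subseteq> closed_segment p b \<union> closed_segment q a"
    using pa bq K(2) by (auto simp: closed_segment_real_mem)
  then have av: "avoids N (closed_segment p q)" using avoids_subset avoids_Un[OF p(3) q(3)] by blast
  have "\<bar>a - b\<bar> \<le> 3 * \<bar>p - a\<bar>"
    using pa bq K(2) by (intro collar_width[OF av _ _ _ \<epsilon> gp gq small]) (auto simp: closed_segment_real_mem)
  moreover have "\<bar>b - a\<bar> \<le> 3 * \<bar>q - b\<bar>"
  proof (rule collar_width[OF _ _ _ _ \<epsilon> gq gp])
    show "avoids N (closed_segment q p)" using av by (simp add: closed_segment_commute)
  qed (use pa bq K(2) small in \<open>auto simp: closed_segment_real_mem abs_minus_commute\<close>)
  ultimately have "p \<le> a - (b - a) / 3" "b + (b - a) / 3 \<le> q"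
    using pa bq K(2) by (simp_all add: field_simps)
  then have "{a - (b - a) / 3..b + (b - a) / 3} \<subseteq> closed_segment p q"
    by (auto simp: closed_segment_real_mem)
  then have "avoids N {a - (b - a) / 3..b + (b - a) / 3}" using avoids_subset[OF av] by blast
  then show "avoids n0 {a - (b - a) / 3..b + (b - a) / 3}"
    using avoids_mono N unfolding N0_def by auto
qed

lemma no_homterval:
  assumes "homterval {a..b}" "a < b" "x0 \<in> {a..b}"
  shows False
proof -
  have grow: "\<exists>a' b'. homterval {a'..b'} \<and> x0 \<in> {a'..b'} \<and> b' - a' = (5 / 3) ^ n * (b - a)" for n
  proof (induction n)
    case 0 then show ?case using assms by (intro exI[of _ a] exI[of _ b]) auto
  next
    case (Suc n)
    then obtain a' b' where h: "homterval {a'..b'}" "x0 \<in> {a'..b'}" "b' - a' = (5 / 3) ^ n * (b - a)" by blast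
    have "0 < b' - a'" unfolding h(3) using assms(2) by simp
    then have "homterval {a' - (b' - a') / 3..b' + (b' - a') / 3}"
      using homterval_thicken[OF h(1) _ h(2)] by simp
    moreover have "x0 \<in> {a' - (b' - a') / 3..b' + (b' - a') / 3}"
      using h(2) \<open>0 < b' - a'\<close> by (simp add: field_simps)
    moreover have "b' + (b' - a') / 3 - (a' - (b' - a') / 3) = (5 / 3) ^ Suc n * (b - a)"
      using h(3) by (simp add: field_simps)
    ultimately show ?case by blast
  qed
  obtain n where n: "1 / (b - a) < (5 / 3) ^ n" using real_arch_pow[of "5 / 3" "1 / (b - a)"] by auto
  obtain a' b' where h: "homterval {a'..b'}" "x0 \<in> {a'..b'}" "b' - a' = (5 / 3) ^ n * (b - a)" using grow by blast
  have "a' \<in> {0..1}" "b' \<in> {0..1}" using h(1,2) unfolding homterval_iff by (auto simp: subset_iff)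
  then have "(5 / 3) ^ n * (b - a) \<le> 1" using h(3) by auto
  moreover have "1 < (5 / 3) ^ n * (b - a)" using n assms(2) by (simp add: field_simps)
  ultimately show False by linarith
qed

end

section \<open>From a wandering interval to a homterval with a suitable base point\<close>

context interval_map
begin

lemma no_wandering_interval: "\<not> wandering_interval f J"
proof
  assume "wandering_interval f J"
  then have J: "is_interval J" "J \<subseteq> {0..1}" "\<exists>a\<in>J. \<exists>b\<in>J. a < b"
    and disj: "\<And>m n. m \<noteq> n \<Longrightarrow> (f ^^ m) ` J \<inter> (f ^^ n) ` J = {}"
    and nobasin: "\<And>Orb. attracting_periodic_orbit f Orb \<Longrightarrow> \<not> J \<subseteq> basin f Orb"
    and homeo: "\<And>n. n > 0 \<Longrightarrow> \<exists>g. homeomorphism J ((f ^^ n) ` J) (f ^^ n) g"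
    unfolding wandering_interval_def by blast+
  have reg: "is_interval ((f ^^ n) ` J)" "inj_on (f ^^ n) J" for n
  proof -
    have "continuous_on J (f ^^ n) \<and> inj_on (f ^^ n) J"
    proof (cases "n = 0")
      case True then show ?thesis by (simp add: inj_on_def continuous_on_id')
    next
      case False
      then obtain g where "homeomorphism J ((f ^^ n) ` J) (f ^^ n) g" using homeo by blast
      then show ?thesis unfolding homeomorphism_def by (metis inj_on_inverseI)
    qed
    then show "is_interval ((f ^^ n) ` J)" "inj_on (f ^^ n) J"
      using J(1) connected_continuous_image is_interval_connected_1 by metis+
  qed
  have shrink: "(\<lambda>n. \<bar>(f ^^ n) x - (f ^^ n) y\<bar>) \<longlonglongrightarrow> 0" if "x \<in> J" "y \<in> J" for x y
  proof (rule disjoint_segments_shrink)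
    show "(f ^^ n) x \<in> {0..1}" "(f ^^ n) y \<in> {0..1}" for n using that J(2) funpow_maps by blast+
    have "closed_segment ((f ^^ n) x) ((f ^^ n) y) \<subseteq> (f ^^ n) ` J" for n
      using reg(1)[of n] that by (intro closed_segment_subset) (auto simp: is_interval_convex_1)
    then show "closed_segment ((f ^^ m) x) ((f ^^ m) y) \<inter> closed_segment ((f ^^ n) x) ((f ^^ n) y) = {}"
      if "m \<noteq> n" for m n using disj[OF that] by blast
  qed
  have no_return: "n = m" if "homterval I" "is_interval I" "x \<in> J" "(f ^^ n) x \<in> I" "(f ^^ m) x \<in> I" for I x n m
  proof -
    have False if I: "homterval I" "is_interval I" and x: "x \<in> J"
      and nm: "(f ^^ n) x \<in> I" "(f ^^ m) x \<in> I" "n < m" for n m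
    proof -
      have "(f ^^ (m - n)) ((f ^^ n) x) \<in> I"
        using nm by (simp add: funpow_add[symmetric, THEN fun_cong, unfolded o_apply])
      then obtain Orb where Orb: "periodic_orbit f Orb" "(f ^^ n) x \<in> basin f Orb"
        using homterval_returning_point[OF I nm(1), of "m - n"] nm(3) by auto
      have "(\<lambda>k. infdist ((f ^^ (k + n)) x) Orb) \<longlonglongrightarrow> 0"
        using Orb(2) unfolding basin_def by (simp add: funpow_add)
      then have lim: "(\<lambda>k. infdist ((f ^^ k) x) Orb) \<longlonglongrightarrow> 0" by (rule LIMSEQ_offset)
      \<comment> \<open>Points of \<open>J\<close> have asymptotic orbits by \<open>shrink\<close>,
        so one point attracted to \<open>Orb\<close> takes all of \<open>J\<close> along; the basin
        then has interior, which makes \<open>Orb\<close> attracting.\<close>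
      have "J \<subseteq> basin f Orb"
      proof
        fix y assume y: "y \<in> J"
        have lim2: "(\<lambda>k. infdist ((f ^^ k) x) Orb + \<bar>(f ^^ k) x - (f ^^ k) y\<bar>) \<longlonglongrightarrow> 0"
          using tendsto_add[OF lim shrink[OF x y]] by simp
        have "norm (infdist ((f ^^ k) y) Orb) \<le> infdist ((f ^^ k) x) Orb + \<bar>(f ^^ k) x - (f ^^ k) y\<bar>" for k
          using infdist_triangle[of "(f ^^ k) y" Orb "(f ^^ k) x"] infdist_nonneg[of "(f ^^ k) y" Orb]
          unfolding dist_real_def by (simp add: abs_minus_commute)
        then have "(\<lambda>k. infdist ((f ^^ k) y) Orb) \<longlonglongrightarrow> 0"
          by (intro Lim_null_comparison[OF always_eventually lim2]) blast
        then show "y \<in> basin f Orb" unfolding basin_def using y J(2) by blast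
      qed
      moreover have "interior (basin f Orb) \<noteq> {}"
      proof -
        obtain a b where ab: "a \<in> J" "b \<in> J" "a < b" using J(3) by blast
        then have "{a<..<b} \<subseteq> basin f Orb"
          using J(1) \<open>J \<subseteq> basin f Orb\<close> unfolding is_interval_1 by (meson greaterThanLessThan_iff less_imp_le subset_iff)
        then have "{a<..<b} \<subseteq> interior (basin f Orb)" by (rule interior_maximal) simp
        then show ?thesis using ab(3) dense[of a b] by auto
      qed
      ultimately show False using nobasin Orb(1) unfolding attracting_periodic_orbit_def by blast
    qed
    then show ?thesis using that by (metis linorder_neqE_nat)
  qed
  \<comment> \<open>Disjoint iterates that meet the finite set \<open>C\<close> contain different
    points of it, so there are only finitely many of them.\<close>
  have "\<exists>n1. \<forall>n\<ge>n1. (f ^^ n) ` J \<inter> C = {}"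
  proof -
    have "finite {n. (f ^^ n) ` J \<inter> C \<noteq> {}}"
    proof (rule inj_on_finite[OF _ _ finite_C])
      define h where "h n = (SOME c. c \<in> (f ^^ n) ` J \<inter> C)" for n
      have h: "h n \<in> (f ^^ n) ` J \<inter> C" if "(f ^^ n) ` J \<inter> C \<noteq> {}" for n
        unfolding h_def using that by (rule some_in_eq[THEN iffD2])
      show "inj_on h {n. (f ^^ n) ` J \<inter> C \<noteq> {}}"
      proof (rule inj_onI, rule ccontr)
        fix m n assume "m \<in> {n. (f ^^ n) ` J \<inter> C \<noteq> {}}" "n \<in> {n. (f ^^ n) ` J \<inter> C \<noteq> {}}" "h m = h n" "m \<noteq> n"
        then show False using h[of m] h[of n] disj[of m n] by auto
      qed
      show "h ` {n. (f ^^ n) ` J \<inter> C \<noteq> {}} \<subseteq> C" using h by auto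
    qed
    then obtain n1 where "\<forall>n\<in>{n. (f ^^ n) ` J \<inter> C \<noteq> {}}. n < n1"
      using finite_nat_set_iff_bounded by blast
    then have "(f ^^ n) ` J \<inter> C = {}" if "n \<ge> n1" for n
      using that unfolding linorder_not_le[symmetric] by blast
    then show ?thesis by blast
  qed
  then obtain n1 where n1: "\<And>n. n \<ge> n1 \<Longrightarrow> (f ^^ n) ` J \<inter> C = {}" by blast
  have homJ: "homterval ((f ^^ n) ` J)" if "n \<ge> n1" for n
  proof -
    have "(f ^^ k) ` (f ^^ n) ` J \<inter> C = {}" for k
      using n1[of "k + n"] that by (simp add: funpow_add image_comp)
    then show ?thesis unfolding homterval_iff using J(2) funpow_maps by blast
  qed
  obtain x where x: "x \<in> J" using J(3) by blast
  \<comment> \<open>Times at which a homterval interval joins the orbit to the boundary point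
    \<open>e\<close>. Two such intervals share \<open>e\<close>, so by \<open>no_return\<close>
    applied to their union there is at most one such time; starting the orbit later gives
    \<open>no_boundary\<close>.\<close>
  define bad where "bad e n \<longleftrightarrow> (\<exists>I. homterval I \<and> is_interval I \<and> (f ^^ n) x \<in> I \<and> e \<in> I)" for e :: real and n
  have bad_unique: "n = m" if bd: "bad e n" "bad e m" for e n m
  proof -
    obtain I I' where I: "homterval I" "is_interval I" "(f ^^ n) x \<in> I" "e \<in> I"
      "homterval I'" "is_interval I'" "(f ^^ m) x \<in> I'" "e \<in> I'"
      using bd unfolding bad_def by blast
    have "connected (I \<union> I')" using I by (intro connected_Un) (auto simp: is_interval_connected)
    then show ?thesis
      using no_return[of "I \<union> I'" x n m] homterval_Un I x by (auto simp: is_interval_connected_1)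
  qed
  obtain n2 where n2: "\<And>n. n \<ge> n2 \<Longrightarrow> \<not> bad 0 n \<and> \<not> bad 1 n"
  proof -
    have "\<exists>k. \<forall>n\<ge>k. \<not> bad e n" for e
    proof (cases "\<exists>m. bad e m")
      case True
      then obtain m where "bad e m" by blast
      then have "\<not> bad e n" if "n \<ge> Suc m" for n using bad_unique[of e n m] that by auto
      then show ?thesis by blast
    qed blast
    then obtain k0 k1 where "\<forall>n\<ge>k0. \<not> bad 0 n" "\<forall>n\<ge>k1. \<not> bad 1 n" by metis
    then show ?thesis using that[of "max k0 k1"] by simp
  qed
  define n3 where "n3 = max n1 n2"
  define x0 where "x0 = (f ^^ n3) x"
  have orb: "(f ^^ n) x0 = (f ^^ (n + n3)) x" for n unfolding x0_def by (simp add: funpow_add)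
  interpret wandering_point f Df C l x0
  proof
    show "n = m" if "homterval I" "is_interval I" "(f ^^ n) x0 \<in> I" "(f ^^ m) x0 \<in> I" for I n m
      using no_return[OF that(1,2) x, of "n + n3" "m + n3"] that(3,4) unfolding orb by simp
    show "0 \<notin> I \<and> 1 \<notin> I" if "homterval I" "is_interval I" "(f ^^ n) x0 \<in> I" for I n
      using n2[of "n + n3"] that unfolding bad_def orb n3_def by auto
  qed
  have J3: "is_interval ((f ^^ n3) ` J)" "homterval ((f ^^ n3) ` J)" "x0 \<in> (f ^^ n3) ` J"
    using reg(1) homJ[of n3] x unfolding n3_def x0_def by auto
  have "\<exists>y\<in>(f ^^ n3) ` J. y \<noteq> x0"
  proof -
    obtain a b where "a \<in> J" "b \<in> J" "a < b" using J(3) by blast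
    then show ?thesis using reg(2)[of n3] by (metis image_eqI inj_on_def less_irrefl)
  qed
  then obtain y where y: "y \<in> (f ^^ n3) ` J" "y \<noteq> x0" by blast
  define a b where "a = min x0 y" and "b = max x0 y"
  have "{a..b} = closed_segment x0 y"
    unfolding a_def b_def by (auto simp: closed_segment_eq_real_ivl)
  then have "{a..b} \<subseteq> (f ^^ n3) ` J"
    using J3(1,3) y(1) closed_segment_subset is_interval_convex_1 by metis
  then have "homterval {a..b}" using homterval_subset J3(2) by blast
  moreover have "a < b" "x0 \<in> {a..b}" using y(2) unfolding a_def b_def by auto
  ultimately show False by (rule no_homterval)
qed

end

theorem theoremA:
  fixes f :: "real \<Rightarrow> real"
  assumes "class_A f"
  shows "\<not> (\<exists>J. wandering_interval f J)"
proof -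
  obtain C Df l where "interval_map f Df C l"
    using assms unfolding class_A_def
  proof (elim conjE exE, goal_cases)
    case (1 C Df l)
    show thesis by (rule 1(1)[of Df C l], unfold_locales) (use 1(2-) in blast)+
  qed
  then show ?thesis using interval_map.no_wandering_interval by blast
qed

end
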